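(* Let $\nu\in(0,\min\{\lambda/\kappa,\varsigma\})$, and let $\{(X^k,Y^k)\}$ (with intermediate iterates $(\bar X^k,\bar Y^k)$, $k\ge1$) be a sequence generated by Algorithm A described in the context. Then: (i) There exist $\hat K>0$ and $\hat{\mathcal I}_X,\hat{\mathcal I}_Y\subseteq[d]$ such that for any $k\ge\hat K$: $\mathcal I_{X^k}=\hat{\mathcal I}_X$, $\mathcal I_{Y^k}=\hat{\mathcal I}_Y$, $(X^k,Y^k)=(\bar X^k,\bar Y^k)$, and $(X^k,Y^k)$ has the column bound-$\nu$ property. (ii) If $|\mathcal K|=+\infty$, then $(X^k,Y^k)$ has the column consistency property for all $k>\min\{k\in\mathcal K:k\ge\hat K-1\}$. (iii) For any accumulation point $(X^*,Y^* )$ of $\{(X^k,Y^k)\}$: $(X^*,Y^* )\in\mathcal S^s_0$ if $|\mathcal K|=+\infty$, and $S(X^*,Y^* )\in\mathcal S^s_0$ otherwise, where $\mathcal S^s_0$ is the set of strong stationary points of the problem $\min_{(X,Y)\in\Omega^1\times\Omega^2}f(XY^{\mathbb T})+\lambda(\mathrm{nnzc}(X)+\mathrm{nnzc}(Y))$.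
   Context: Setting. Let $m\ge n\ge1$, $d\ge1$ be integers, $\lambda>0$, $\varsigma>0$, $[d]=\{1,\dots,d\}$. $\|\cdot\|$ is the Euclidean norm of vectors and the spectral norm of matrices. For $C\in\mathbb R^{r\times d}$: $C_i$ is the $i$-th column, $\mathcal I_C:=\{i\in[d]:C_i\ne0\}$, $\mathrm{nnzc}(C):=|\mathcal I_C|$; for $J\subseteq[d]$, $J^c=[d]\setminus J$, $C_J$ is the submatrix of the columns indexed by $J$, and $\mathcal C_J:=\{Z_J:Z\in\mathcal C\}$ for sets $\mathcal C$ (conditions on an empty set of columns are vacuous). $\Omega^1:=\{X\in\mathbb R^{m\times d}:\|X_i\|\le\varsigma\ \forall i\}$, $\Omega^2:=\{Y\in\mathbb R^{n\times d}:\|Y_i\|\le\varsigma\ \forall i\}$. $f:\mathbb R^{m\times n}\to\mathbb R$ is locally Lipschitz and differentiable, and $\nabla f$ is Lipschitz continuous with modulus $L_f$ on $\{XY^{\mathbb T}:(X,Y)\in\Omega^1\times\Omega^2\}$; $\nabla_Zf(XY^{\mathbb T})$ is $\nabla f$ at $XY^{\mathbb T}$. $\partial_Zf(XY^{\mathbb T})$ is the limiting subdifferential of $f$ at $XY^{\mathbb T}$. $\kappa>0$ is a constant with $\max\{\|HY_i\|,\|H^{\mathbb T}X_i\|\}\le\kappa$ for all $(X,Y)\in\Omega^1\times\Omega^2$, $H\in\partial_Zf(XY^{\mathbb T})$, $i\in[d]$. $N_{\mathcal S}$ is the normal cone to a closed convex set $\mathcal S$. For $\tau>0$, $t\ge0$: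 $\theta_{\tau,1}(t):=t/\tau$, $\theta_{\tau,2}(t):=1$, $\theta_\tau(t):=\min\{\theta_{\tau,1}(t),\theta_{\tau,2}(t)\}$; $\Theta_\tau(C):=\sum_{i=1}^d\theta_\tau(\|C_i\|)$ and, for $I\in\{1,2\}^d$, $\Theta_{\tau,I}(C):=\sum_{i=1}^d\theta_{\tau,I_i}(\|C_i\|)$. Properties. $(X,Y)$ has the column consistency property if $\mathcal I_X=\mathcal I_Y$, and the column bound-$\nu$ property if $\|X_i\|\notin(0,\nu)$ and $\|Y_i\|\notin(0,\nu)$ for all $i\in[d]$. $(X,Y)\in\Omega^1\times\Omega^2$ is a strong stationary point of $\min_{\Omega^1\times\Omega^2}f(XY^{\mathbb T})+\lambda(\mathrm{nnzc}(X)+\mathrm{nnzc}(Y))$ if it has both properties and there is $H\in\partial_Zf(XY^{\mathbb T})$ such that, with $\mathcal I=\mathcal I_X\cap\mathcal I_Y$, $0\in HY_{\mathcal I}+N_{\Omega^1_{\mathcal I}}(X_{\mathcal I})$ and $0\in H^{\mathbb T}X_{\mathcal I}+N_{\Omega^2_{\mathcal I}}(Y_{\mathcal I})$. $S(X,Y):=(X^s,Y^s)$ with $X^s_{\mathcal I}=X_{\mathcal I}$, $X^s_{\mathcal I^c}=0$, $Y^s_{\mathcal I}=Y_{\mathcal I}$, $Y^s_{\mathcal I^c}=0$, $\mathcal I=\mathcal I_X\cap\mathcal I_Y$. Algorithm A. Choose $(X^0,Y^0)\in\Omega^1\times\Omega^2$, $0<c_{\min}<c_{\max}$, $0<\underline\iota<\overline\iota$,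 $\rho>1$, $\mathcal K\subseteq\mathbb N$ ($\mathbb N$ = nonnegative integers), $K\in\mathbb N$, and positive numbers $\nu_k$ with $\nu_k=\nu$ for all $k\ge K$. For $k=0,1,2,\dots$: Step 1. Let $I^k_i:=\max\{j\in\{1,2\}:\theta_{\nu_k,j}(\|X^k_i\|)=\theta_{\nu_k}(\|X^k_i\|)\}$, $i\in[d]$. Choose $\iota^B_{1,k}\in[\underline\iota,\overline\iota]$, $c_{1,k}\in[c_{\min},c_{\max}]$. For $t=1,2,\dots$, with $\iota_{1,k}=\iota^B_{1,k}\rho^{t-1}$, compute $\bar X^{k+1}(\iota_{1,k})=\arg\min_{X\in\Omega^1}\{f(X^k{Y^k}^{\mathbb T})+\langle\nabla_Zf(X^k{Y^k}^{\mathbb T})Y^k,X-X^k\rangle+\frac{\iota_{1,k}}2\|X-X^k\|_F^2+\lambda\Theta_{\nu_k,I^k}(X)\}$, until $f(\bar X^{k+1}(\iota_{1,k}){Y^k}^{\mathbb T})+\lambda\Theta_{\nu_k}(\bar X^{k+1}(\iota_{1,k}))\le f(X^k{Y^k}^{\mathbb T})+\lambda\Theta_{\nu_k}(X^k)-c_{1,k}\|\bar X^{k+1}(\iota_{1,k})-X^k\|_F^2$; for the first such $t$, set $\bar X^{k+1}=\bar X^{k+1}(\iota_{1,k})$, $\bar\iota_{1,k}=\iota_{1,k}$. Step 2. Let $J^k_i:=\max\{j\in\{1,2\}:\theta_{\nu_k,j}(\|Y^k_i\|)=\theta_{\nu_k}(\|Y^k_i\|)\}$. Choose $\iota^B_{2,k}\in[\underline\iota,\overline\iota]$,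 $c_{2,k}\in[c_{\min},c_{\max}]$. For $t=1,2,\dots$, with $\iota_{2,k}=\iota^B_{2,k}\rho^{t-1}$, compute $\bar Y^{k+1}(\iota_{2,k})=\arg\min_{Y\in\Omega^2}\{f(\bar X^{k+1}{Y^k}^{\mathbb T})+\langle\nabla_Zf(\bar X^{k+1}{Y^k}^{\mathbb T})^{\mathbb T}\bar X^{k+1},Y-Y^k\rangle+\frac{\iota_{2,k}}2\|Y-Y^k\|_F^2+\lambda\Theta_{\nu_k,J^k}(Y)\}$, until $f(\bar X^{k+1}\bar Y^{k+1}(\iota_{2,k})^{\mathbb T})+\lambda\Theta_{\nu_k}(\bar Y^{k+1}(\iota_{2,k}))\le f(\bar X^{k+1}{Y^k}^{\mathbb T})+\lambda\Theta_{\nu_k}(Y^k)-c_{2,k}\|\bar Y^{k+1}(\iota_{2,k})-Y^k\|_F^2$; for the first such $t$, set $\bar Y^{k+1}=\bar Y^{k+1}(\iota_{2,k})$, $\bar\iota_{2,k}=\iota_{2,k}$. Step 3. $(X^{k+1},Y^{k+1})=S(\bar X^{k+1},\bar Y^{k+1})$ if $k\in\mathcal K$, and $(X^{k+1},Y^{k+1})=(\bar X^{k+1},\bar Y^{k+1})$ otherwise. *)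

theory Defs
  imports "HOL-Analysis.Analysis"
begin

text \<open>
  A matrix with rows indexed by \<^typ>\<open>'r\<close> and columns indexed by \<^typ>\<open>'d\<close> has type
  \<^typ>\<open>real^'d^'r\<close>. On this type the library's inner product and norm are the Frobenius ones,
  and \<^const>\<open>norm\<close> of a column is its Euclidean norm.
\<close>

section \<open>Variational analysis\<close>

definition frechet_subdiff :: "('a::real_inner \<Rightarrow> real) \<Rightarrow> 'a \<Rightarrow> 'a set" where
  "frechet_subdiff f x =
     {v. 0 \<le> Liminf (at x) (\<lambda>y. ereal ((f y - f x - v \<bullet> (y - x)) / norm (y - x)))}"

definition limiting_subdiff :: "('a::real_inner \<Rightarrow> real) \<Rightarrow> 'a \<Rightarrow> 'a set" where
  "limiting_subdiff f x =
     {v. \<exists>xs vs. xs \<longlonglongrightarrow> x \<and> (\<lambda>k. f (xs k)) \<longlonglongrightarrow> f x \<and>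
           (\<forall>k. vs k \<in> frechet_subdiff f (xs k)) \<and> vs \<longlonglongrightarrow> v}"

text \<open>The normal cone, taken in the subspace \<open>V\<close>, to a closed convex set \<open>S \<subseteq> V\<close>.\<close>

definition normal_cone :: "'a::real_inner set \<Rightarrow> 'a set \<Rightarrow> 'a \<Rightarrow> 'a set" where
  "normal_cone V S x = (if x \<in> S then {v \<in> V. \<forall>z\<in>S. v \<bullet> (z - x) \<le> 0} else {})"

definition locally_lipschitz :: "('a::metric_space \<Rightarrow> 'b::metric_space) \<Rightarrow> bool" where
  "locally_lipschitz f \<longleftrightarrow> (\<forall>x. \<exists>e>0. \<exists>L. L-lipschitz_on (ball x e) f)"

definition accumulation_point :: "(nat \<Rightarrow> 'a::topological_space) \<Rightarrow> 'a \<Rightarrow> bool" where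
  "accumulation_point s l \<longleftrightarrow> (\<exists>r. strict_mono r \<and> (s \<circ> r) \<longlonglongrightarrow> l)"

section \<open>Columns\<close>

definition col_supp :: "real^'d^'r \<Rightarrow> 'd set" where
  "col_supp C = {i. column i C \<noteq> 0}"

text \<open>
  The submatrix of the columns in \<open>J\<close> is represented by the matrix with the same columns in
  \<open>J\<close> and zero columns elsewhere; the space of matrices with column index set \<open>J\<close> is
  thereby identified isometrically with the subspace \<open>col_space J\<close>.
\<close>

definition col_space :: "'d set \<Rightarrow> (real^'d^'r) set" where
  "col_space J = {C. \<forall>i. i \<notin> J \<longrightarrow> column i C = 0}"

definition col_sub :: "'d set \<Rightarrow> real^'d^'r \<Rightarrow> real^'d^'r" where
  "col_sub J C = (\<chi> a i. if i \<in> J then C $ a $ i else 0)"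

definition Omega :: "real \<Rightarrow> (real^'d^'r) set" where
  "Omega \<sigma> = {C. \<forall>i. norm (column i C) \<le> \<sigma>}"

definition col_consistent :: "real^'d^'m \<Rightarrow> real^'d^'n \<Rightarrow> bool" where
  "col_consistent X Y \<longleftrightarrow> col_supp X = col_supp Y"

definition col_bound :: "real \<Rightarrow> real^'d^'m \<Rightarrow> real^'d^'n \<Rightarrow> bool" where
  "col_bound \<nu> X Y \<longleftrightarrow>
     (\<forall>i. norm (column i X) \<notin> {0<..<\<nu>} \<and> norm (column i Y) \<notin> {0<..<\<nu>})"

definition S_map :: "real^'d^'m \<Rightarrow> real^'d^'n \<Rightarrow> (real^'d^'m) \<times> (real^'d^'n)" where
  "S_map X Y = (let J = col_supp X \<inter> col_supp Y in
     ((\<chi> a i. if i \<in> J then X $ a $ i else 0), (\<chi> a i. if i \<in> J then Y $ a $ i else 0)))"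

text \<open>
  Strong stationary points of the minimization of
  \<open>f (X ** transpose Y) + lam * (card (col_supp X) + card (col_supp Y))\<close> over
  \<open>Omega \<sigma> \<times> Omega \<sigma>\<close>; the notion does not involve the value of \<open>lam\<close>.
\<close>

definition strong_stationary ::
  "(real^'n^'m \<Rightarrow> real) \<Rightarrow> real \<Rightarrow> real \<Rightarrow> ((real^'d^'m) \<times> (real^'d^'n)) set" where
  "strong_stationary f \<sigma> \<nu> =
     {(X, Y). X \<in> Omega \<sigma> \<and> Y \<in> Omega \<sigma> \<and> col_consistent X Y \<and> col_bound \<nu> X Y \<and>
        (let J = col_supp X \<inter> col_supp Y in
          \<exists>H \<in> limiting_subdiff f (X ** transpose Y).
            0 \<in> (+) (H ** col_sub J Y) `
                  normal_cone (col_space J) (col_sub J ` Omega \<sigma>) (col_sub J X) \<and>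
            0 \<in> (+) (transpose H ** col_sub J X) `
                  normal_cone (col_space J) (col_sub J ` Omega \<sigma>) (col_sub J Y))}"

section \<open>Surrogates of the number of nonzero columns\<close>

definition theta_piece :: "real \<Rightarrow> nat \<Rightarrow> real \<Rightarrow> real" where
  "theta_piece \<tau> j t = (if j = 1 then t / \<tau> else 1)"

definition theta :: "real \<Rightarrow> real \<Rightarrow> real" where
  "theta \<tau> t = min (theta_piece \<tau> 1 t) (theta_piece \<tau> 2 t)"

definition Theta :: "real \<Rightarrow> real^'d^'r \<Rightarrow> real" where
  "Theta \<tau> C = (\<Sum>i\<in>UNIV. theta \<tau> (norm (column i C)))"

definition Theta_piece :: "real \<Rightarrow> ('d \<Rightarrow> nat) \<Rightarrow> real^'d^'r \<Rightarrow> real" where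
  "Theta_piece \<tau> I C = (\<Sum>i\<in>UNIV. theta_piece \<tau> (I i) (norm (column i C)))"

definition active_piece :: "real \<Rightarrow> real^'d^'r \<Rightarrow> 'd \<Rightarrow> nat" where
  "active_piece \<tau> C i =
     Max {j \<in> {1, 2}. theta_piece \<tau> j (norm (column i C)) = theta \<tau> (norm (column i C))}"

section \<open>The algorithm\<close>

text \<open>
  \<open>backtracking q S acc \<iota> \<rho> Z\<close>: minimizing \<open>q (\<iota> * \<rho> ^ (t - 1))\<close> over \<open>S\<close> for
  \<open>t = 1, 2, \<dots>\<close>, the first minimizer accepted by \<open>acc\<close> is \<open>Z\<close>.
\<close>

definition backtracking ::
  "(real \<Rightarrow> 'a \<Rightarrow> real) \<Rightarrow> 'a set \<Rightarrow> ('a \<Rightarrow> bool) \<Rightarrow> real \<Rightarrow> real \<Rightarrow> 'a \<Rightarrow> bool" where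
  "backtracking q S acc \<iota> \<rho> Z \<longleftrightarrow>
     (\<exists>t\<ge>1. is_arg_min (q (\<iota> * \<rho> ^ (t - 1))) (\<lambda>W. W \<in> S) Z \<and> acc Z \<and>
        (\<forall>s\<in>{1..<t}. \<forall>W. is_arg_min (q (\<iota> * \<rho> ^ (s - 1))) (\<lambda>W. W \<in> S) W \<longrightarrow> \<not> acc W))"

definition X_step ::
  "(real^'n^'m \<Rightarrow> real) \<Rightarrow> (real^'n^'m \<Rightarrow> real^'n^'m) \<Rightarrow> real \<Rightarrow> real \<Rightarrow> real \<Rightarrow>
   real \<Rightarrow> real \<Rightarrow> real \<Rightarrow> real^'d^'m \<Rightarrow> real^'d^'n \<Rightarrow> real^'d^'m \<Rightarrow> bool" where
  "X_step f gradf \<sigma> lam \<rho> \<nu> \<iota> c X Y X' \<longleftrightarrow>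
     backtracking
       (\<lambda>\<iota> W. f (X ** transpose Y) + (gradf (X ** transpose Y) ** Y) \<bullet> (W - X)
              + \<iota> / 2 * (norm (W - X))\<^sup>2 + lam * Theta_piece \<nu> (active_piece \<nu> X) W)
       (Omega \<sigma>)
       (\<lambda>W. f (W ** transpose Y) + lam * Theta \<nu> W
              \<le> f (X ** transpose Y) + lam * Theta \<nu> X - c * (norm (W - X))\<^sup>2)
       \<iota> \<rho> X'"

definition Y_step ::
  "(real^'n^'m \<Rightarrow> real) \<Rightarrow> (real^'n^'m \<Rightarrow> real^'n^'m) \<Rightarrow> real \<Rightarrow> real \<Rightarrow> real \<Rightarrow>
   real \<Rightarrow> real \<Rightarrow> real \<Rightarrow> real^'d^'m \<Rightarrow> real^'d^'n \<Rightarrow> real^'d^'n \<Rightarrow> bool" where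
  "Y_step f gradf \<sigma> lam \<rho> \<nu> \<iota> c X' Y Y' \<longleftrightarrow>
     backtracking
       (\<lambda>\<iota> W. f (X' ** transpose Y) + (transpose (gradf (X' ** transpose Y)) ** X') \<bullet> (W - Y)
              + \<iota> / 2 * (norm (W - Y))\<^sup>2 + lam * Theta_piece \<nu> (active_piece \<nu> Y) W)
       (Omega \<sigma>)
       (\<lambda>W. f (X' ** transpose W) + lam * Theta \<nu> W
              \<le> f (X' ** transpose Y) + lam * Theta \<nu> Y - c * (norm (W - Y))\<^sup>2)
       \<iota> \<rho> Y'"

text \<open>
  \<open>(Xb k, Yb k)\<close> are the intermediate iterates for \<open>k \<ge> 1\<close>; \<open>(Xb 0, Yb 0)\<close> is
  unconstrained and irrelevant.
\<close>

definition generated_by_algorithm ::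
  "(real^'n^'m \<Rightarrow> real) \<Rightarrow> (real^'n^'m \<Rightarrow> real^'n^'m) \<Rightarrow> real \<Rightarrow> real \<Rightarrow>
   real \<Rightarrow> real \<Rightarrow> real \<Rightarrow> real \<Rightarrow> real \<Rightarrow> nat set \<Rightarrow> (nat \<Rightarrow> real) \<Rightarrow>
   (nat \<Rightarrow> real^'d^'m) \<Rightarrow> (nat \<Rightarrow> real^'d^'n) \<Rightarrow>
   (nat \<Rightarrow> real^'d^'m) \<Rightarrow> (nat \<Rightarrow> real^'d^'n) \<Rightarrow> bool" where
  "generated_by_algorithm f gradf \<sigma> lam cmin cmax \<iota>min \<iota>max \<rho> KK nus X Y Xb Yb \<longleftrightarrow>
     X 0 \<in> Omega \<sigma> \<and> Y 0 \<in> Omega \<sigma> \<and>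
     (\<forall>k.
       (\<exists>\<iota>\<in>{\<iota>min..\<iota>max}. \<exists>c\<in>{cmin..cmax}.
          X_step f gradf \<sigma> lam \<rho> (nus k) \<iota> c (X k) (Y k) (Xb (Suc k))) \<and>
       (\<exists>\<iota>\<in>{\<iota>min..\<iota>max}. \<exists>c\<in>{cmin..cmax}.
          Y_step f gradf \<sigma> lam \<rho> (nus k) \<iota> c (Xb (Suc k)) (Y k) (Yb (Suc k))) \<and>
       (X (Suc k), Y (Suc k)) =
         (if k \<in> KK then S_map (Xb (Suc k)) (Yb (Suc k)) else (Xb (Suc k), Yb (Suc k))))"

end

theory Submission
  imports Defs
begin

text \<open>
  Everything is driven by a single column in a single block update. Both the surrogate and the
  constraint set are separable over columns, so each column of an update solves its own proximal
  problem, in which only the gradient column \<open>g\<close>, with \<open>norm g \<le> \<kappa>\<close>, sees the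
  rest of the matrix. Once \<open>nus k = \<nu>\<close>, there are two regimes
  (\<open>backtracking_step_columns\<close>). A column of norm below \<open>\<nu>\<close> is penalized by
  \<open>lam / \<nu> * norm w\<close>, whose slope exceeds \<open>\<kappa>\<close>; its norm drops by at least
  \<open>(lam / \<nu> - \<kappa>) / M\<close> unless it becomes zero, where \<open>M\<close> bounds all accepted
  proximal weights. A column of norm at least \<open>\<nu>\<close> has a constant penalty, and its update
  is a projected gradient step. The bound \<open>M\<close> exists because the gradient is Lipschitz along
  the segments joining products with one common factor, so that large weights are always accepted
  (\<open>product_majorants\<close>, \<open>backtracking_weight_bounded\<close>).

  Hence every column either stays above \<open>\<nu>\<close> forever or is zero from some point on
  (\<open>shrinking_dichotomy\<close>); truncation by \<open>S_map\<close> only sends columns to the absorbing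
  state zero. As there are finitely many columns, the supports become constant, no truncation
  changes anything any more, and the bound property holds (\<open>block_stabilizes\<close>). If a truncation
  takes place after that moment, it leaves equal supports, which then stay equal.

  From then on the algorithm is a descent method for the continuous function
  \<open>f (X ** transpose Y) + lam * Theta \<nu> X + lam * Theta \<nu> Y\<close>, which is bounded below
  on the feasible set, so that consecutive iterates approach each other. The first-order conditions
  of the columns in the supports hold up to an error of the size of the steps, and they pass to
  accumulation points, with the gradient as the required subgradient. Columns at
  an accumulation point again have norm zero or at least \<open>\<nu>\<close>, according to the same
  supports. Finally, truncating to the common support changes neither the product nor the
  surviving columns, so it turns the two separate conditions into strong stationarity
  (\<open>S_map_strong_stationary\<close>), and it is the identity when the supports agree.
\<close>

section \<open>Columns of a matrix\<close>

lemma column_add [simp]: "column i (A + B) = column i A + column i B"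
  by (simp add: column_def vec_eq_iff)

lemma column_diff [simp]: "column i (A - B) = column i A - column i B"
  by (simp add: column_def vec_eq_iff)

lemma column_uminus [simp]: "column i (- A) = - column i (A :: real^'d^'r)"
  by (simp add: column_def vec_eq_iff)

lemma column_scaleR [simp]: "column i (c *\<^sub>R A) = c *\<^sub>R column i A"
  by (simp add: column_def vec_eq_iff)

lemma column_zero [simp]: "column i (0 :: real^'d^'r) = 0"
  by (simp add: column_def vec_eq_iff)

lemma column_col_sub: "column i (col_sub J C) = (if i \<in> J then column i C else 0)"
  by (simp add: column_def col_sub_def vec_eq_iff)

lemma column_matrix_mult: "column i (A ** B) = A *v column i B"
  by (simp add: column_def matrix_matrix_mult_def matrix_vector_mult_def vec_eq_iff)

lemma matrix_eqI_columns: "(\<And>i. column i A = column i B) \<Longrightarrow> A = B"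
  by (simp add: column_def vec_eq_iff)

lemma inner_columns: "(A :: real^'d^'r) \<bullet> B = (\<Sum>i\<in>UNIV. column i A \<bullet> column i B)"
  unfolding inner_vec_def column_def by (simp add: sum.swap[of _ "UNIV :: 'd set"])

lemma norm_columns: "(norm (A :: real^'d^'r))\<^sup>2 = (\<Sum>i\<in>UNIV. (norm (column i A))\<^sup>2)"
  by (simp add: power2_norm_eq_inner inner_columns)

lemma tendsto_column [tendsto_intros]:
  "(A \<longlongrightarrow> L) F \<Longrightarrow> ((\<lambda>x. column i (A x)) \<longlongrightarrow> column i L) F"
  unfolding column_def by (intro tendsto_vec_lambda tendsto_vec_nth)

lemma continuous_on_column [continuous_intros]:
  "continuous_on S A \<Longrightarrow> continuous_on S (\<lambda>x. column i (A x))"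
  unfolding continuous_on_def by (auto intro: tendsto_column)

lemma tendsto_matrix_vector_mult:
  fixes A :: "'a \<Rightarrow> real^'d^'r"
  assumes "(A \<longlongrightarrow> A0) F" and "(v \<longlongrightarrow> v0) F"
  shows "((\<lambda>x. A x *v v x) \<longlongrightarrow> A0 *v v0) F"
  unfolding matrix_vector_mult_def
  by (intro tendsto_vec_lambda tendsto_sum tendsto_mult tendsto_vec_nth assms)

lemma tendsto_transpose:
  "(A \<longlongrightarrow> A0) F \<Longrightarrow> ((\<lambda>x. transpose (A x)) \<longlongrightarrow> transpose A0) F"
  unfolding transpose_def by (intro tendsto_vec_lambda tendsto_vec_nth)

lemma convex_Omega: "convex (Omega \<sigma> :: (real^'d^'r) set)"
proof (rule convexI)
  fix A B :: "real^'d^'r" and u v :: real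
  assume AB: "A \<in> Omega \<sigma>" "B \<in> Omega \<sigma>" and uv: "0 \<le> u" "0 \<le> v" "u + v = 1"
  show "u *\<^sub>R A + v *\<^sub>R B \<in> Omega \<sigma>"
    unfolding Omega_def
  proof (intro CollectI allI)
    fix i
    have "u *\<^sub>R column i A + v *\<^sub>R column i B \<in> cball 0 \<sigma>"
      using AB uv by (intro convexD[OF convex_cball]) (auto simp: Omega_def)
    then show "norm (column i (u *\<^sub>R A + v *\<^sub>R B)) \<le> \<sigma>" by simp
  qed
qed

lemma closed_Omega: "closed (Omega \<sigma> :: (real^'d^'r) set)"
  unfolding Omega_def
  by (intro closed_Collect_all closed_Collect_le continuous_intros)

lemma compact_Omega: "compact (Omega \<sigma> :: (real^'d^'r) set)"
proof -
  have "norm C \<le> sqrt (of_nat CARD('d) * \<sigma>\<^sup>2)" if "C \<in> Omega \<sigma>" for C :: "real^'d^'r"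
  proof (rule real_le_rsqrt)
    have "(norm (column i C))\<^sup>2 \<le> \<sigma>\<^sup>2" for i
      using that by (simp add: Omega_def power_mono)
    then have "(\<Sum>i\<in>UNIV. (norm (column i C))\<^sup>2) \<le> of_nat CARD('d) * \<sigma>\<^sup>2"
      by (intro sum_bounded_above) auto
    then show "(norm C)\<^sup>2 \<le> of_nat CARD('d) * \<sigma>\<^sup>2" by (simp add: norm_columns)
  qed
  then have "bounded (Omega \<sigma> :: (real^'d^'r) set)" by (auto simp: bounded_iff)
  with closed_Omega show ?thesis by (simp add: compact_eq_bounded_closed)
qed

lemma col_sub_Omega: "0 \<le> \<sigma> \<Longrightarrow> C \<in> Omega \<sigma> \<Longrightarrow> col_sub J C \<in> Omega \<sigma>"
  by (simp add: Omega_def column_col_sub)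

lemma S_map_col_sub:
  "S_map X Y = (col_sub (col_supp X \<inter> col_supp Y) X, col_sub (col_supp X \<inter> col_supp Y) Y)"
  by (simp add: S_map_def col_sub_def)

lemma col_supp_col_sub: "J \<subseteq> col_supp C \<Longrightarrow> col_supp (col_sub J C) = J"
  by (auto simp: col_supp_def column_col_sub)

lemma col_sub_col_supp: "col_supp C \<subseteq> J \<Longrightarrow> col_sub J C = C"
  by (rule matrix_eqI_columns) (auto simp: col_supp_def column_col_sub)

section \<open>Products of factors\<close>

lemma bounded_bilinear_mult_transpose:
  "bounded_bilinear (\<lambda>(A :: real^'d^'m) (B :: real^'d^'n). A ** transpose B)"
  unfolding bilinear_conv_bounded_bilinear[symmetric] bilinear_def
  by (auto intro!: linearI
      simp: matrix_matrix_mult_def transpose_def vec_eq_iff algebra_simps sum.distrib sum_distrib_left)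

lemma inner_mult_transpose_left:
  fixes H :: "real^'n^'m" and A :: "real^'d^'m" and B :: "real^'d^'n"
  shows "H \<bullet> (A ** transpose B) = (H ** B) \<bullet> A"
proof -
  have "H \<bullet> (A ** transpose B) = (\<Sum>a\<in>UNIV. \<Sum>b\<in>UNIV. \<Sum>i\<in>UNIV. H $ a $ b * (A $ a $ i * B $ b $ i))"
    by (simp add: inner_vec_def matrix_matrix_mult_def transpose_def sum_distrib_left)
  also have "\<dots> = (\<Sum>a\<in>UNIV. \<Sum>i\<in>UNIV. \<Sum>b\<in>UNIV. H $ a $ b * (A $ a $ i * B $ b $ i))"
    by (rule sum.cong[OF refl], rule sum.swap)
  also have "\<dots> = (H ** B) \<bullet> A"
    by (simp add: inner_vec_def matrix_matrix_mult_def sum_distrib_left sum_distrib_right mult_ac)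
  finally show ?thesis .
qed

lemma inner_transpose: "transpose A \<bullet> transpose B = (A :: real^'n^'m) \<bullet> B"
  unfolding inner_vec_def transpose_def by (simp, rule sum.swap)

lemma inner_mult_transpose_right:
  fixes H :: "real^'n^'m" and A :: "real^'d^'m" and B :: "real^'d^'n"
  shows "H \<bullet> (A ** transpose B) = (transpose H ** A) \<bullet> B"
  by (metis inner_mult_transpose_left inner_transpose matrix_transpose_mul transpose_transpose)

text \<open>
  A product is the sum of the outer products of corresponding columns, so that a column which
  vanishes in one factor may be erased from the other.
\<close>

lemma mult_transpose_col_sub:
  assumes "\<And>i. i \<notin> J \<Longrightarrow> column i A = 0 \<or> column i B = 0"
  shows "col_sub J A ** transpose (col_sub J B) = (A :: real^'d^'m) ** transpose (B :: real^'d^'n)"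
proof -
  have "(\<Sum>i\<in>UNIV. col_sub J A $ a $ i * col_sub J B $ b $ i) = (\<Sum>i\<in>UNIV. A $ a $ i * B $ b $ i)" for a b
  proof (rule sum.cong[OF refl])
    fix i
    show "col_sub J A $ a $ i * col_sub J B $ b $ i = A $ a $ i * B $ b $ i"
      using assms[of i] by (auto simp: col_sub_def column_def vec_eq_iff)
  qed
  then show ?thesis
    by (simp add: matrix_matrix_mult_def transpose_def vec_eq_iff)
qed

section \<open>Differentiable functions\<close>

lemma gradient_in_limiting_subdiff:
  fixes f :: "'a::euclidean_space \<Rightarrow> real"
  assumes "GDERIV f x :> g"
  shows "g \<in> limiting_subdiff f x"
proof -
  have "((\<lambda>y. (f y - f x - g \<bullet> (y - x)) / norm (y - x)) \<longlongrightarrow> 0) (at x)"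
    using assms unfolding gderiv_def has_derivative_def
    by (simp add: inner_commute divide_inverse mult.commute)
  then have "((\<lambda>y. ereal ((f y - f x - g \<bullet> (y - x)) / norm (y - x))) \<longlongrightarrow> ereal 0) (at x)"
    by (rule tendsto_ereal)
  then have "Liminf (at x) (\<lambda>y. ereal ((f y - f x - g \<bullet> (y - x)) / norm (y - x))) = ereal 0"
    by (rule lim_imp_Liminf[OF at_neq_bot])
  then have "g \<in> frechet_subdiff f x" by (simp add: frechet_subdiff_def)
  then show ?thesis
    unfolding limiting_subdiff_def
    by (intro CollectI exI[of _ "\<lambda>_. x"] exI[of _ "\<lambda>_. g"]) auto
qed

text \<open>
  Only the segment between the two points has to lie in the set on which the gradient is Lipschitz.
  The mean value theorem gives \<open>L\<close> in place of the sharp constant \<open>L / 2\<close>; the size of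
  the constant only affects how long backtracking may last.
\<close>

lemma lipschitz_gradient_majorant:
  fixes f :: "'a::euclidean_space \<Rightarrow> real"
  assumes grad: "\<And>x. GDERIV f x :> g x"
    and lip: "L-lipschitz_on S g" and seg: "closed_segment u v \<subseteq> S"
  shows "f v \<le> f u + g u \<bullet> (v - u) + L * (norm (v - u))\<^sup>2"
proof -
  let ?p = "\<lambda>t. u + t *\<^sub>R (v - u)"
  have "((\<lambda>t. f (?p t)) has_real_derivative (v - u) \<bullet> g (?p t)) (at t)" for t
  proof -
    have p: "(?p has_derivative (\<lambda>h. h *\<^sub>R (v - u))) (at t)"
      by (auto intro!: derivative_eq_intros)
    have "(f has_derivative (\<lambda>h. h \<bullet> g (?p t))) (at (?p t))"
      using grad[of "?p t"] by (simp add: gderiv_def)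
    from diff_chain_at[OF p this]
    have "((\<lambda>t. f (?p t)) has_derivative (\<lambda>h. h * ((v - u) \<bullet> g (?p t)))) (at t)"
      by (simp add: o_def)
    then show ?thesis by (simp add: has_field_derivative_def mult_commute_abs)
  qed
  then have "\<exists>t>0. t < 1 \<and> f (?p 1) - f (?p 0) = (1 - 0) * ((v - u) \<bullet> g (?p t))"
    by (intro MVT2) auto
  then obtain t where t: "0 < t" "t < 1" and mvt: "f v - f u = (v - u) \<bullet> g (?p t)" by auto
  have "?p t \<in> closed_segment u v"
    unfolding closed_segment_def
    by (intro CollectI exI[of _ t]) (use t in \<open>auto simp: algebra_simps\<close>)
  with seg have S: "?p t \<in> S" "u \<in> S" by auto
  have "norm (g (?p t) - g u) \<le> L * (t * norm (v - u))"
    using lipschitz_onD[OF lip S] t by (simp add: dist_norm)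
  also have "\<dots> \<le> L * norm (v - u)"
    using t lipschitz_on_nonneg[OF lip] by (intro mult_left_mono) (auto intro: mult_left_le_one_le)
  finally have "norm (g (?p t) - g u) \<le> L * norm (v - u)" .
  then have "norm (v - u) * norm (g (?p t) - g u) \<le> norm (v - u) * (L * norm (v - u))"
    by (intro mult_left_mono) auto
  moreover have "(v - u) \<bullet> (g (?p t) - g u) \<le> norm (v - u) * norm (g (?p t) - g u)"
    by (rule norm_cauchy_schwarz)
  ultimately have "(v - u) \<bullet> (g (?p t) - g u) \<le> L * (norm (v - u))\<^sup>2"
    by (simp add: power2_eq_square mult_ac)
  with mvt show ?thesis by (simp add: inner_diff_right inner_commute)
qed

section \<open>A single backtracking step\<close>

text \<open>
  If moving from \<open>w\<close> towards \<open>z\<close> by a fraction \<open>t\<close> changes the objective by at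
  most \<open>t * D + t\<^sup>2 * b\<close>, then minimality of \<open>w\<close> forces \<open>D \<ge> 0\<close>; convexity of
  the penalty bounds its share of the change linearly in \<open>t\<close>.
\<close>

lemma proximal_variational_inequality:
  fixes g x w z :: "'a::real_inner"
  assumes conv: "convex B" and p: "convex_on B p" and w: "w \<in> B" and z: "z \<in> B"
    and min: "\<And>y. y \<in> B \<Longrightarrow> g \<bullet> (w - x) + s / 2 * (norm (w - x))\<^sup>2 + p w
                            \<le> g \<bullet> (y - x) + s / 2 * (norm (y - x))\<^sup>2 + p y"
  shows "0 \<le> (g + s *\<^sub>R (w - x)) \<bullet> (z - w) + p z - p w"
proof -
  let ?D = "(g + s *\<^sub>R (w - x)) \<bullet> (z - w) + p z - p w"
  let ?b = "s / 2 * (norm (z - w))\<^sup>2"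
  define c where "c = (w - x) \<bullet> (z - w)"
  have D: "?D = g \<bullet> (z - w) + s * c + p z - p w"
    by (simp add: c_def inner_add_left)
  have "0 \<le> ?D + t * ?b" if t: "0 < t" "t < 1" for t
  proof -
    let ?y = "w + t *\<^sub>R (z - w)"
    have y: "?y = (1 - t) *\<^sub>R w + t *\<^sub>R z" by (simp add: algebra_simps)
    have "?y \<in> B"
      unfolding y using conv w z t by (intro convexD) auto
    have "p ?y \<le> (1 - t) * p w + t * p z"
      unfolding y using t w z by (intro convex_onD[OF p]) auto
    moreover have "g \<bullet> (?y - x) = g \<bullet> (w - x) + t * (g \<bullet> (z - w))"
      by (simp add: inner_diff_right inner_add_right algebra_simps)
    moreover have "(norm (?y - x))\<^sup>2 = (norm (w - x))\<^sup>2 + 2 * t * c + t\<^sup>2 * (norm (z - w))\<^sup>2"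
      unfolding power2_norm_eq_inner c_def
      by (simp add: inner_add_left inner_add_right inner_diff_left inner_diff_right inner_commute
          power2_eq_square algebra_simps)
    ultimately have "p w \<le> t * (g \<bullet> (z - w)) + s / 2 * (2 * t * c + t\<^sup>2 * (norm (z - w))\<^sup>2)
        + (1 - t) * p w + t * p z"
      using min[OF \<open>?y \<in> B\<close>] by (simp add: distrib_left)
    also have "\<dots> = p w + t * (?D + t * ?b)"
      unfolding D by (simp add: power2_eq_square field_simps)
    finally have "0 \<le> t * (?D + t * ?b)" by simp
    with t show ?thesis by (simp add: zero_le_mult_iff)
  qed
  then have "eventually (\<lambda>t. 0 \<le> ?D + t * ?b) (at_right 0)"
    unfolding eventually_at_right_field by (intro exI[of _ 1]) auto
  moreover have "((\<lambda>t. ?D + t * ?b) \<longlongrightarrow> ?D + 0 * ?b) (at_right 0)"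
    by (intro tendsto_intros)
  ultimately have "0 \<le> ?D + 0 * ?b"
    by (intro tendsto_lowerbound) auto
  then show ?thesis by simp
qed

text \<open>
  Testing the variational inequality with \<open>z = 0\<close> gives
  \<open>\<mu> - \<kappa> \<le> s * (norm x - norm w)\<close> for \<open>w \<noteq> 0\<close>: a penalty slope above every
  possible gradient pushes a nonzero column towards the origin by a fixed amount.
\<close>

lemma norm_penalty_shrinks:
  fixes g x w :: "'a::real_inner"
  assumes min: "\<And>y. norm y \<le> \<sigma> \<Longrightarrow> g \<bullet> (w - x) + s / 2 * (norm (w - x))\<^sup>2 + \<mu> * norm w
                            \<le> g \<bullet> (y - x) + s / 2 * (norm (y - x))\<^sup>2 + \<mu> * norm y"
    and w: "norm w \<le> \<sigma>" and g: "norm g \<le> \<kappa>" and \<kappa>: "\<kappa> < \<mu>" and s: "0 < s" "s \<le> M"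
  shows "w = 0 \<or> norm w \<le> norm x - (\<mu> - \<kappa>) / M"
proof (cases "w = 0")
  case False
  have \<mu>: "0 \<le> \<mu>" using \<kappa> g norm_ge_zero[of g] by linarith
  have \<sigma>: "0 \<le> \<sigma>" using w norm_ge_zero[of w] by linarith
  have "0 \<le> (g + s *\<^sub>R (w - x)) \<bullet> (0 - w) + \<mu> * norm (0 :: 'a) - \<mu> * norm w"
  proof (rule proximal_variational_inequality[where B = "cball 0 \<sigma>" and p = "\<lambda>y. \<mu> * norm y"])
    show "convex_on (cball 0 \<sigma>) (\<lambda>y. \<mu> * norm y)"
      using \<mu> convex_on_dist[OF convex_cball, of 0 \<sigma> 0] by (intro convex_on_cmul) auto
  qed (use w \<sigma> min in auto)
  then have "\<mu> * norm w \<le> - (g \<bullet> w) + s * (x \<bullet> w) - s * (w \<bullet> w)"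
    by (simp add: inner_add_left inner_diff_left algebra_simps)
  also have "\<dots> \<le> \<kappa> * norm w + s * (norm x * norm w) - s * (norm w * norm w)"
  proof -
    have "- (g \<bullet> w) \<le> norm g * norm w" using norm_cauchy_schwarz[of "- g" w] by simp
    also have "\<dots> \<le> \<kappa> * norm w" using g by (simp add: mult_right_mono)
    finally have "- (g \<bullet> w) \<le> \<kappa> * norm w" .
    moreover have "s * (x \<bullet> w) \<le> s * (norm x * norm w)"
      using s norm_cauchy_schwarz[of x w] by simp
    moreover have "w \<bullet> w = norm w * norm w"
      by (metis power2_eq_square power2_norm_eq_inner)
    ultimately show ?thesis by simp
  qed
  finally have "norm w * (\<mu> - \<kappa>) \<le> norm w * (s * (norm x - norm w))"
    by (simp add: algebra_simps)
  with False have *: "\<mu> - \<kappa> \<le> s * (norm x - norm w)" by simp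
  with \<kappa> s have "0 \<le> norm x - norm w" by (smt (verit) zero_less_mult_iff)
  then have "s * (norm x - norm w) \<le> M * (norm x - norm w)"
    using s by (intro mult_right_mono) auto
  with * s have "(\<mu> - \<kappa>) / M \<le> norm x - norm w"
    by (simp add: pos_divide_le_eq mult.commute)
  then show ?thesis by simp
qed simp

text \<open>
  The residual \<open>s *\<^sub>R (w - x)\<close> of the proximal term is estimated through the bound
  \<open>M\<close> on \<open>s\<close>, so that the conclusion no longer depends on the accepted weight and
  passes to the limit when the steps tend to zero.
\<close>

lemma constant_penalty_variational_inequality:
  fixes g x w z :: "'a::real_inner"
  assumes min: "\<And>y. norm y \<le> \<sigma> \<Longrightarrow> g \<bullet> (w - x) + s / 2 * (norm (w - x))\<^sup>2
                            \<le> g \<bullet> (y - x) + s / 2 * (norm (y - x))\<^sup>2"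
    and w: "norm w \<le> \<sigma>" and z: "norm z \<le> \<sigma>" and s: "0 < s" "s \<le> M"
  shows "0 \<le> g \<bullet> (z - w) + M * norm (w - x) * norm (z - w)"
proof -
  have "0 \<le> (g + s *\<^sub>R (w - x)) \<bullet> (z - w) + 0 - 0"
    by (rule proximal_variational_inequality[where B = "cball 0 \<sigma>" and p = "\<lambda>_. 0"])
      (use w z min in \<open>auto simp: convex_on_def\<close>)
  then have "0 \<le> g \<bullet> (z - w) + s * ((w - x) \<bullet> (z - w))"
    by (simp add: inner_add_left)
  also have "s * ((w - x) \<bullet> (z - w)) \<le> M * (norm (w - x) * norm (z - w))"
    using s norm_cauchy_schwarz[of "w - x" "z - w"]
    by (smt (verit) mult_left_mono mult_right_mono mult_nonneg_nonneg norm_ge_zero)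
  finally show ?thesis by (simp add: mult.assoc)
qed

lemma active_piece_eq:
  assumes "0 < \<tau>"
  shows "active_piece \<tau> C i = (if norm (column i C) < \<tau> then 1 else 2)"
proof -
  let ?t = "norm (column i C)"
  have "{j \<in> {1, 2 :: nat}. theta_piece \<tau> j ?t = theta \<tau> ?t} =
      (if ?t < \<tau> then {1} else if ?t = \<tau> then {1, 2} else {2})"
    using assms by (auto simp: theta_def theta_piece_def min_def divide_simps split: if_splits)
  then show ?thesis unfolding active_piece_def by simp
qed

lemma Theta_piece_active:
  assumes "0 < \<tau>"
  shows "Theta_piece \<tau> (active_piece \<tau> X) X = Theta \<tau> X"
  unfolding Theta_piece_def Theta_def active_piece_eq[OF assms] theta_def theta_piece_def
  using assms by (intro sum.cong) (auto simp: min_def divide_simps)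

lemma Theta_le_Theta_piece: "Theta \<tau> W \<le> Theta_piece \<tau> I W"
  unfolding Theta_piece_def Theta_def theta_def theta_piece_def by (intro sum_mono) auto

text \<open>
  The common form of the trial objectives of both blocks; \<open>a\<close> and \<open>G\<close> stand for the
  value and the partial gradient, at the current point, of the objective as a function of the block.
\<close>

definition prox_model ::
  "real \<Rightarrow> real^'d^'r \<Rightarrow> real^'d^'r \<Rightarrow> real \<Rightarrow> real \<Rightarrow> real \<Rightarrow> real^'d^'r \<Rightarrow> real" where
  "prox_model a G X lam \<tau> s W =
     a + G \<bullet> (W - X) + s / 2 * (norm (W - X))\<^sup>2 + lam * Theta_piece \<tau> (active_piece \<tau> X) W"

lemma prox_model_has_minimizer:
  assumes "0 < \<sigma>"
  shows "\<exists>W. is_arg_min (prox_model a G X lam \<tau> s) (\<lambda>W. W \<in> Omega \<sigma>) (W :: real^'d^'r)"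
proof -
  have piece: "continuous_on (Omega \<sigma>) (\<lambda>W :: real^'d^'r. theta_piece \<tau> j (norm (column i W)))" for i j
    unfolding theta_piece_def divide_inverse by (cases "j = 1") (auto intro!: continuous_intros)
  have "continuous_on (Omega \<sigma>) (prox_model a G X lam \<tau> s)"
    unfolding prox_model_def[abs_def] Theta_piece_def by (intro continuous_intros piece)
  moreover have "(0 :: real^'d^'r) \<in> Omega \<sigma>"
    using assms by (simp add: Omega_def)
  ultimately obtain W :: "real^'d^'r" where "W \<in> Omega \<sigma>"
    "\<forall>V\<in>Omega \<sigma>. prox_model a G X lam \<tau> s W \<le> prox_model a G X lam \<tau> s V"
    using continuous_attains_inf[OF compact_Omega] by blast
  then show ?thesis by (auto simp: is_arg_min_linorder)
qed

text \<open>The model and the constraint are separable, so each column solves its own problem.\<close>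

lemma prox_model_minimizer_column:
  fixes G X X' :: "real^'d^'r"
  assumes min: "is_arg_min (prox_model a G X lam \<tau> s) (\<lambda>W. W \<in> Omega \<sigma>) X'"
    and z: "norm z \<le> \<sigma>"
  shows "column i G \<bullet> (column i X' - column i X) + s / 2 * (norm (column i X' - column i X))\<^sup>2
           + lam * theta_piece \<tau> (active_piece \<tau> X i) (norm (column i X'))
         \<le> column i G \<bullet> (z - column i X) + s / 2 * (norm (z - column i X))\<^sup>2
           + lam * theta_piece \<tau> (active_piece \<tau> X i) (norm z)"
proof -
  define h where "h = (\<lambda>j v. column j G \<bullet> (v - column j X) + s / 2 * (norm (v - column j X))\<^sup>2
           + lam * theta_piece \<tau> (active_piece \<tau> X j) (norm v))"
  have split: "prox_model a G X lam \<tau> s W = a + (\<Sum>j\<in>UNIV. h j (column j W))" for W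
    by (simp add: prox_model_def h_def Theta_piece_def inner_columns[of G] norm_columns
        sum.distrib sum_distrib_left)
  define W :: "real^'d^'r" where "W = (\<chi> r j. if j = i then z $ r else X' $ r $ j)"
  have colW: "column j W = (if j = i then z else column j X')" for j
    by (simp add: W_def column_def vec_eq_iff)
  have "X' \<in> Omega \<sigma>" using min by (simp add: is_arg_min_linorder)
  then have "W \<in> Omega \<sigma>" using z by (simp add: Omega_def colW)
  then have "prox_model a G X lam \<tau> s X' \<le> prox_model a G X lam \<tau> s W"
    using min by (simp add: is_arg_min_linorder)
  then have "(\<Sum>j\<in>UNIV. h j (column j X')) \<le> (\<Sum>j\<in>UNIV. h j (column j W))"
    by (simp add: split)
  moreover have "(\<Sum>j\<in>UNIV - {i}. h j (column j W)) = (\<Sum>j\<in>UNIV - {i}. h j (column j X'))"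
    by (intro sum.cong) (auto simp: colW)
  ultimately have "h i (column i X') \<le> h i z"
    by (simp add: sum.remove[of UNIV i] colW)
  then show ?thesis by (simp add: h_def)
qed

text \<open>
  The majorant makes every trial with \<open>s \<ge> 2 * (L + c)\<close> acceptable: the proximal term then
  dominates the error of the linearization and still leaves the required decrease. The last
  rejected weight is therefore below that threshold, and the accepted one is \<open>\<rho>\<close> times
  as large, unless the initial weight \<open>\<iota>\<close> is accepted at once.
\<close>

lemma backtracking_weight_bounded:
  fixes X X' G :: "real^'d^'r"
  assumes bt: "backtracking (prox_model (\<phi> X) G X lam \<tau>) (Omega \<sigma>)
       (\<lambda>W. \<phi> W + lam * Theta \<tau> W \<le> \<phi> X + lam * Theta \<tau> X - c * (norm (W - X))\<^sup>2) \<iota> \<rho> X'"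
    and major: "\<And>W. W \<in> Omega \<sigma> \<Longrightarrow> \<phi> W \<le> \<phi> X + G \<bullet> (W - X) + L * (norm (W - X))\<^sup>2"
    and X: "X \<in> Omega \<sigma>" and pos: "0 < \<sigma>" "0 \<le> lam" "0 < \<tau>" "1 < \<rho>"
    and \<iota>: "0 < \<iota>" "\<iota> \<le> \<iota>max" and c: "c \<le> cmax"
  obtains s where "0 < s" "s \<le> max \<iota>max (2 * \<rho> * (L + cmax))"
    "is_arg_min (prox_model (\<phi> X) G X lam \<tau> s) (\<lambda>W. W \<in> Omega \<sigma>) X'"
proof -
  let ?acc = "\<lambda>W. \<phi> W + lam * Theta \<tau> W \<le> \<phi> X + lam * Theta \<tau> X - c * (norm (W - X))\<^sup>2"
  obtain t where t: "t \<ge> 1"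
    and min: "is_arg_min (prox_model (\<phi> X) G X lam \<tau> (\<iota> * \<rho> ^ (t - 1))) (\<lambda>W. W \<in> Omega \<sigma>) X'"
    and rej: "\<And>r W. r \<in> {1..<t} \<Longrightarrow>
       is_arg_min (prox_model (\<phi> X) G X lam \<tau> (\<iota> * \<rho> ^ (r - 1))) (\<lambda>W. W \<in> Omega \<sigma>) W \<Longrightarrow> \<not> ?acc W"
    using bt unfolding backtracking_def by blast
  have "\<iota> * \<rho> ^ (t - 1) \<le> max \<iota>max (2 * \<rho> * (L + cmax))"
  proof (cases "t = 1")
    case False
    then have r: "t - 1 \<in> {1..<t}" using t by auto
    define s where "s = \<iota> * \<rho> ^ (t - 1 - 1)"
    obtain W where W: "is_arg_min (prox_model (\<phi> X) G X lam \<tau> s) (\<lambda>W. W \<in> Omega \<sigma>) W"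
      using prox_model_has_minimizer pos(1) by blast
    have "s < 2 * (L + c)"
    proof (rule ccontr)
      assume "\<not> s < 2 * (L + c)"
      then have "(L + c) * (norm (W - X))\<^sup>2 \<le> s / 2 * (norm (W - X))\<^sup>2"
        by (intro mult_right_mono) auto
      then have "L * (norm (W - X))\<^sup>2 + c * (norm (W - X))\<^sup>2 \<le> s / 2 * (norm (W - X))\<^sup>2"
        by (simp only: distrib_right)
      moreover have "prox_model (\<phi> X) G X lam \<tau> s W \<le> prox_model (\<phi> X) G X lam \<tau> s X"
        using W X by (simp add: is_arg_min_linorder)
      then have "\<phi> X + G \<bullet> (W - X) + s / 2 * (norm (W - X))\<^sup>2
          + lam * Theta_piece \<tau> (active_piece \<tau> X) W \<le> \<phi> X + lam * Theta \<tau> X"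
        using pos by (simp add: prox_model_def Theta_piece_active)
      moreover have "lam * Theta \<tau> W \<le> lam * Theta_piece \<tau> (active_piece \<tau> X) W"
        using pos by (intro mult_left_mono Theta_le_Theta_piece)
      moreover have "\<phi> W \<le> \<phi> X + G \<bullet> (W - X) + L * (norm (W - X))\<^sup>2"
        using W by (intro major) (simp add: is_arg_min_linorder)
      ultimately have "?acc W"
        by linarith
      with rej[OF r] W show False by (simp add: s_def)
    qed
    also have "\<dots> \<le> 2 * (L + cmax)" using c by simp
    finally have "\<rho> * s \<le> 2 * \<rho> * (L + cmax)" using pos by simp
    moreover have "Suc (t - 1 - 1) = t - 1" using False t by simp
    then have "\<rho> ^ (t - 1) = \<rho> * \<rho> ^ (t - 1 - 1)" by (metis power_Suc)
    then have "\<iota> * \<rho> ^ (t - 1) = \<rho> * s" by (simp add: s_def)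
    ultimately show ?thesis by simp
  qed (use \<iota> in simp)
  moreover have "0 < \<iota> * \<rho> ^ (t - 1)" using \<iota> pos by simp
  ultimately show ?thesis using that min by blast
qed

text \<open>
  The two regimes of a column in one step. Below the threshold \<open>\<tau>\<close> the active piece is
  the linear one, of slope \<open>lam / \<tau> > \<kappa>\<close>, and the column shrinks. At or above it the
  active piece is constant, and what remains is a first-order condition up to an error of the size
  of the step.
\<close>

lemma backtracking_step_columns:
  fixes X X' G :: "real^'d^'r"
  assumes bt: "backtracking (prox_model (\<phi> X) G X lam \<tau>) (Omega \<sigma>)
       (\<lambda>W. \<phi> W + lam * Theta \<tau> W \<le> \<phi> X + lam * Theta \<tau> X - c * (norm (W - X))\<^sup>2) \<iota> \<rho> X'"
    and major: "\<And>W. W \<in> Omega \<sigma> \<Longrightarrow> \<phi> W \<le> \<phi> X + G \<bullet> (W - X) + L * (norm (W - X))\<^sup>2"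
    and X: "X \<in> Omega \<sigma>" and pos: "0 < \<sigma>" "0 \<le> lam" "0 < \<tau>" "1 < \<rho>"
    and \<iota>: "0 < \<iota>" "\<iota> \<le> \<iota>max" and c: "c \<le> cmax"
    and G: "norm (column i G) \<le> \<kappa>" and \<kappa>: "\<kappa> < lam / \<tau>"
    and M: "M = max \<iota>max (2 * \<rho> * (L + cmax))"
  shows "norm (column i X) < \<tau> \<Longrightarrow>
           column i X' = 0 \<or> norm (column i X') \<le> norm (column i X) - (lam / \<tau> - \<kappa>) / M"
    and "\<tau> \<le> norm (column i X) \<Longrightarrow> norm z \<le> \<sigma> \<Longrightarrow>
           0 \<le> column i G \<bullet> (z - column i X') + M * norm (column i X' - column i X) * norm (z - column i X')"
proof -
  obtain s where s: "0 < s" "s \<le> M"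
    and min: "is_arg_min (prox_model (\<phi> X) G X lam \<tau> s) (\<lambda>W. W \<in> Omega \<sigma>) X'"
    using backtracking_weight_bounded[OF bt major X pos \<iota> c] M by blast
  have X': "norm (column i X') \<le> \<sigma>"
    using min by (simp add: is_arg_min_linorder Omega_def)
  note col = prox_model_minimizer_column[OF min, of _ i]
  show "column i X' = 0 \<or> norm (column i X') \<le> norm (column i X) - (lam / \<tau> - \<kappa>) / M"
    if "norm (column i X) < \<tau>"
    using col that pos
    by (intro norm_penalty_shrinks[OF _ X' G \<kappa> s]) (simp add: active_piece_eq theta_piece_def)
  show "0 \<le> column i G \<bullet> (z - column i X') + M * norm (column i X' - column i X) * norm (z - column i X')"
    if "\<tau> \<le> norm (column i X)" "norm z \<le> \<sigma>"
    using col that pos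
    by (intro constant_penalty_variational_inequality[OF _ X' _ s])
      (simp_all add: active_piece_eq theta_piece_def)
qed

section \<open>The two block updates\<close>

lemma backtracking_minimizer:
  "backtracking q S acc \<iota> \<rho> Z \<Longrightarrow> Z \<in> S \<and> acc Z"
  unfolding backtracking_def by (auto simp: is_arg_min_def)

lemma X_step_prox_model:
  "X_step f gradf \<sigma> lam \<rho> \<nu> \<iota> c X Y X' \<longleftrightarrow>
     backtracking (prox_model (f (X ** transpose Y)) (gradf (X ** transpose Y) ** Y) X lam \<nu>) (Omega \<sigma>)
       (\<lambda>W. f (W ** transpose Y) + lam * Theta \<nu> W
              \<le> f (X ** transpose Y) + lam * Theta \<nu> X - c * (norm (W - X))\<^sup>2) \<iota> \<rho> X'"
  by (simp add: X_step_def prox_model_def[abs_def])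

lemma Y_step_prox_model:
  "Y_step f gradf \<sigma> lam \<rho> \<nu> \<iota> c X Y Y' \<longleftrightarrow>
     backtracking (prox_model (f (X ** transpose Y)) (transpose (gradf (X ** transpose Y)) ** X) Y lam \<nu>)
       (Omega \<sigma>)
       (\<lambda>W. f (X ** transpose W) + lam * Theta \<nu> W
              \<le> f (X ** transpose Y) + lam * Theta \<nu> Y - c * (norm (W - Y))\<^sup>2) \<iota> \<rho> Y'"
  by (simp add: Y_step_def prox_model_def[abs_def])

lemma X_step_accepted:
  assumes "X_step f gradf \<sigma> lam \<rho> \<nu> \<iota> c X Y X'"
  shows "X' \<in> Omega \<sigma>"
    and "f (X' ** transpose Y) + lam * Theta \<nu> X'
           \<le> f (X ** transpose Y) + lam * Theta \<nu> X - c * (norm (X' - X))\<^sup>2"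
  using backtracking_minimizer[OF assms[unfolded X_step_prox_model]] by simp_all

lemma Y_step_accepted:
  assumes "Y_step f gradf \<sigma> lam \<rho> \<nu> \<iota> c X Y Y'"
  shows "Y' \<in> Omega \<sigma>"
    and "f (X ** transpose Y') + lam * Theta \<nu> Y'
           \<le> f (X ** transpose Y) + lam * Theta \<nu> Y - c * (norm (Y' - Y))\<^sup>2"
  using backtracking_minimizer[OF assms[unfolded Y_step_prox_model]] by simp_all

text \<open>
  The set of products is not convex, but with one factor fixed it contains the segments on which
  the mean value theorem is applied.
\<close>

lemma product_majorants:
  fixes f :: "real^'n^'m \<Rightarrow> real" and gradf :: "real^'n^'m \<Rightarrow> real^'n^'m"
  assumes f_grad: "\<And>Z. GDERIV f Z :> gradf Z"
    and lip: "Lf-lipschitz_on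
          {P ** transpose Q | (P :: real^'d^'m) (Q :: real^'d^'n). P \<in> Omega \<sigma> \<and> Q \<in> Omega \<sigma>} gradf"
  obtains L where "\<And>(P :: real^'d^'m) W (Q :: real^'d^'n). P \<in> Omega \<sigma> \<Longrightarrow> W \<in> Omega \<sigma> \<Longrightarrow> Q \<in> Omega \<sigma> \<Longrightarrow>
       f (W ** transpose Q) \<le> f (P ** transpose Q) + (gradf (P ** transpose Q) ** Q) \<bullet> (W - P)
         + L * (norm (W - P))\<^sup>2"
    and "\<And>(P :: real^'d^'m) W (Q :: real^'d^'n). P \<in> Omega \<sigma> \<Longrightarrow> W \<in> Omega \<sigma> \<Longrightarrow> Q \<in> Omega \<sigma> \<Longrightarrow>
       f (P ** transpose W) \<le> f (P ** transpose Q) + (transpose (gradf (P ** transpose Q)) ** P) \<bullet> (W - Q)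
         + L * (norm (W - Q))\<^sup>2"
proof -
  let ?S = "{P ** transpose Q | (P :: real^'d^'m) (Q :: real^'d^'n). P \<in> Omega \<sigma> \<and> Q \<in> Omega \<sigma>}"
  interpret mul: bounded_bilinear "\<lambda>(A :: real^'d^'m) (B :: real^'d^'n). A ** transpose B"
    by (rule bounded_bilinear_mult_transpose)
  obtain C where C: "0 < C" "\<And>(A :: real^'d^'m) (B :: real^'d^'n). norm (A ** transpose B) \<le> norm A * norm B * C"
    using mul.pos_bounded by blast
  obtain R1 where R1: "0 < R1" "\<And>P :: real^'d^'m. P \<in> Omega \<sigma> \<Longrightarrow> norm P \<le> R1"
    using compact_imp_bounded[OF compact_Omega] unfolding bounded_pos by metis
  obtain R2 where R2: "0 < R2" "\<And>Q :: real^'d^'n. Q \<in> Omega \<sigma> \<Longrightarrow> norm Q \<le> R2"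
    using compact_imp_bounded[OF compact_Omega] unfolding bounded_pos by metis
  define R where "R = max R1 R2"
  define L where "L = Lf * (R * C)\<^sup>2"
  have Lf: "0 \<le> Lf" using lip by (rule lipschitz_on_nonneg)
  have bound: "Lf * (norm V)\<^sup>2 \<le> L * r\<^sup>2" if "norm V \<le> R * C * r" for V :: "real^'n^'m" and r
  proof -
    have "(norm V)\<^sup>2 \<le> (R * C * r)\<^sup>2" using that by (intro power_mono) auto
    then show ?thesis
      using mult_left_mono[OF _ Lf] by (simp add: L_def power_mult_distrib mult.assoc)
  qed
  have left: "f (W ** transpose Q) \<le> f (P ** transpose Q) + (gradf (P ** transpose Q) ** Q) \<bullet> (W - P)
         + L * (norm (W - P))\<^sup>2"
    if "P \<in> Omega \<sigma>" "W \<in> Omega \<sigma>" "Q \<in> Omega \<sigma>" for P W :: "real^'d^'m" and Q :: "real^'d^'n"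
  proof -
    have seg: "closed_segment (P ** transpose Q) (W ** transpose Q) \<subseteq> ?S"
    proof
      fix V assume "V \<in> closed_segment (P ** transpose Q) (W ** transpose Q)"
      then obtain u where u: "0 \<le> u" "u \<le> 1"
        and V: "V = (1 - u) *\<^sub>R (P ** transpose Q) + u *\<^sub>R (W ** transpose Q)"
        by (auto simp: closed_segment_def)
      have "V = ((1 - u) *\<^sub>R P + u *\<^sub>R W) ** transpose Q"
        by (simp only: V mul.add_left mul.scaleR_left)
      moreover have "(1 - u) *\<^sub>R P + u *\<^sub>R W \<in> Omega \<sigma>"
        using that u by (intro convexD[OF convex_Omega]) auto
      ultimately show "V \<in> ?S" using that by blast
    qed
    have diff: "W ** transpose Q - P ** transpose Q = (W - P) ** transpose Q"
      by (simp only: mul.diff_left)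
    have "norm ((W - P) ** transpose Q) \<le> norm (W - P) * norm Q * C" by (rule C)
    also have "\<dots> \<le> norm (W - P) * R * C"
      using R2(2)[OF that(3)] C by (intro mult_right_mono mult_left_mono) (auto simp: R_def)
    finally have "Lf * (norm ((W - P) ** transpose Q))\<^sup>2 \<le> L * (norm (W - P))\<^sup>2"
      by (intro bound) (simp add: mult_ac)
    then show ?thesis
      using lipschitz_gradient_majorant[OF f_grad lip seg]
      by (simp add: diff inner_mult_transpose_left)
  qed
  have right: "f (P ** transpose W) \<le> f (P ** transpose Q) + (transpose (gradf (P ** transpose Q)) ** P) \<bullet> (W - Q)
         + L * (norm (W - Q))\<^sup>2"
    if "P \<in> Omega \<sigma>" "W \<in> Omega \<sigma>" "Q \<in> Omega \<sigma>" for P :: "real^'d^'m" and W Q :: "real^'d^'n"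
  proof -
    have seg: "closed_segment (P ** transpose Q) (P ** transpose W) \<subseteq> ?S"
    proof
      fix V assume "V \<in> closed_segment (P ** transpose Q) (P ** transpose W)"
      then obtain u where u: "0 \<le> u" "u \<le> 1"
        and V: "V = (1 - u) *\<^sub>R (P ** transpose Q) + u *\<^sub>R (P ** transpose W)"
        by (auto simp: closed_segment_def)
      have "V = P ** transpose ((1 - u) *\<^sub>R Q + u *\<^sub>R W)"
        by (simp only: V mul.add_right mul.scaleR_right)
      moreover have "(1 - u) *\<^sub>R Q + u *\<^sub>R W \<in> Omega \<sigma>"
        using that u by (intro convexD[OF convex_Omega]) auto
      ultimately show "V \<in> ?S" using that by blast
    qed
    have diff: "P ** transpose W - P ** transpose Q = P ** transpose (W - Q)"
      by (simp only: mul.diff_right)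
    have "norm (P ** transpose (W - Q)) \<le> norm P * norm (W - Q) * C" by (rule C)
    also have "\<dots> \<le> R * norm (W - Q) * C"
      using R1(2)[OF that(1)] C by (intro mult_right_mono) (auto simp: R_def)
    finally have "Lf * (norm (P ** transpose (W - Q)))\<^sup>2 \<le> L * (norm (W - Q))\<^sup>2"
      by (intro bound) (simp add: mult_ac)
    then show ?thesis
      using lipschitz_gradient_majorant[OF f_grad lip seg]
      by (simp add: diff inner_mult_transpose_right)
  qed
  show thesis using that left right by blast
qed

section \<open>Long-run behaviour of the iterates\<close>

text \<open>
  Below \<open>\<nu>\<close> the norm drops by \<open>\<delta>\<close> in each step until the vector is zero, and
  zero is absorbing because a further drop would make the norm negative.
\<close>

lemma shrinking_dichotomy:
  fixes x :: "nat \<Rightarrow> 'a::real_normed_vector"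
  assumes \<delta>: "0 < \<delta>"
    and step: "\<And>k. K \<le> k \<Longrightarrow> norm (x k) < \<nu> \<Longrightarrow> x (Suc k) = 0 \<or> norm (x (Suc k)) \<le> norm (x k) - \<delta>"
  shows "eventually (\<lambda>k. \<nu> \<le> norm (x k)) sequentially \<or> eventually (\<lambda>k. x k = 0) sequentially"
proof (cases "\<exists>k0\<ge>K. norm (x k0) < \<nu>")
  case False
  then have "eventually (\<lambda>k. \<nu> \<le> norm (x k)) sequentially"
    unfolding eventually_sequentially by (intro exI[of _ K]) (auto simp: not_less)
  then show ?thesis ..
next
  case True
  then obtain k0 where k0: "K \<le> k0" "norm (x k0) < \<nu>" by blast
  have inv: "norm (x (k0 + j)) < \<nu> \<and> (x (k0 + j) = 0 \<or> norm (x (k0 + j)) + j * \<delta> \<le> \<nu>)" for j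
  proof (induction j)
    case 0
    then show ?case using k0 by simp
  next
    case (Suc j)
    have "0 < \<nu>" using k0 norm_ge_zero[of "x k0"] by linarith
    consider "x (Suc (k0 + j)) = 0" | "norm (x (Suc (k0 + j))) \<le> norm (x (k0 + j)) - \<delta>"
      using step[of "k0 + j"] k0 Suc by fastforce
    then show ?case
    proof cases
      case 2
      then have "x (k0 + j) \<noteq> 0"
        using \<delta> norm_ge_zero[of "x (Suc (k0 + j))"] by (smt (verit) norm_zero)
      with 2 Suc \<delta> show ?thesis by (auto simp: algebra_simps)
    qed (use \<open>0 < \<nu>\<close> in simp)
  qed
  obtain n :: nat where n: "\<nu> < n * \<delta>" using reals_Archimedean3[OF \<delta>] by blast
  have "x k = 0" if "k0 + n \<le> k" for k
  proof (rule ccontr)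
    assume "x k \<noteq> 0"
    with inv[of "k - k0"] that have "norm (x k) + (k - k0) * \<delta> \<le> \<nu>" by auto
    moreover have "n * \<delta> \<le> (k - k0) * \<delta>" using that \<delta> by (intro mult_right_mono) auto
    ultimately show False using n norm_ge_zero[of "x k"] by linarith
  qed
  then have "eventually (\<lambda>k. x k = 0) sequentially"
    unfolding eventually_sequentially by blast
  then show ?thesis ..
qed

text \<open>
  \<open>Zb\<close> are the results of the backtracking steps and \<open>Z\<close> the iterates, in which some
  columns of \<open>Zb\<close> may have been erased. Erasing also respects the dichotomy, because zero is
  its absorbing state. Once it is decided, a column of the final support cannot be erased as it stays
  nonzero, and any other column is zero already before the erasure.
\<close>

lemma block_stabilizes:
  fixes Z Zb :: "nat \<Rightarrow> real^'d^'r"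
  assumes \<delta>: "0 < \<delta>" and \<nu>: "0 < \<nu>"
    and erase: "\<And>k i. column i (Z (Suc k)) = 0 \<or> column i (Z (Suc k)) = column i (Zb (Suc k))"
    and step: "\<And>k i. K \<le> k \<Longrightarrow> norm (column i (Z k)) < \<nu> \<Longrightarrow>
          column i (Zb (Suc k)) = 0 \<or> norm (column i (Zb (Suc k))) \<le> norm (column i (Z k)) - \<delta>"
  obtains N I where "K \<le> N" and "\<And>k i. N \<le> k \<Longrightarrow> i \<in> I \<Longrightarrow> \<nu> \<le> norm (column i (Z k))"
    and "\<And>k i. N \<le> k \<Longrightarrow> i \<notin> I \<Longrightarrow> column i (Z k) = 0"
    and "\<And>k. N \<le> k \<Longrightarrow> Z (Suc k) = Zb (Suc k)"
proof -
  have dich: "eventually (\<lambda>k. \<nu> \<le> norm (column i (Z k))) sequentially \<or>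
      eventually (\<lambda>k. column i (Z k) = 0) sequentially" for i
    by (rule shrinking_dichotomy[OF \<delta>, of K]) (metis erase step)
  define I where "I = {i. eventually (\<lambda>k. \<nu> \<le> norm (column i (Z k))) sequentially}"
  have "eventually (\<lambda>k. \<forall>i. (i \<in> I \<longrightarrow> \<nu> \<le> norm (column i (Z k))) \<and> (i \<notin> I \<longrightarrow> column i (Z k) = 0))
      sequentially"
  proof (rule eventually_all_finite)
    fix i
    show "eventually (\<lambda>k. (i \<in> I \<longrightarrow> \<nu> \<le> norm (column i (Z k))) \<and> (i \<notin> I \<longrightarrow> column i (Z k) = 0))
        sequentially"
      using dich[of i] by (cases "i \<in> I") (auto simp: I_def)
  qed
  then obtain N0 where N0: "\<And>k i. N0 \<le> k \<Longrightarrow> i \<in> I \<Longrightarrow> \<nu> \<le> norm (column i (Z k))"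
    "\<And>k i. N0 \<le> k \<Longrightarrow> i \<notin> I \<Longrightarrow> column i (Z k) = 0"
    unfolding eventually_sequentially by blast
  define N where "N = max N0 K"
  have "Z (Suc k) = Zb (Suc k)" if k: "N \<le> k" for k
  proof (rule matrix_eqI_columns)
    fix i
    show "column i (Z (Suc k)) = column i (Zb (Suc k))"
    proof (cases "i \<in> I")
      case True
      then have "column i (Z (Suc k)) \<noteq> 0" using N0(1)[of "Suc k" i] k \<nu> by (auto simp: N_def)
      then show ?thesis using erase by blast
    next
      case False
      then have "column i (Z k) = 0" "column i (Z (Suc k)) = 0" using N0(2) k by (auto simp: N_def)
      moreover from this have "column i (Zb (Suc k)) = 0"
        using step[of k i] k \<nu> \<delta> norm_ge_zero[of "column i (Zb (Suc k))"] by (auto simp: N_def)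
      ultimately show ?thesis by simp
    qed
  qed
  then show thesis using that[of N I] N0 by (auto simp: N_def)
qed

lemma sufficient_decrease_steps_vanish:
  fixes d :: "nat \<Rightarrow> 'a::real_normed_vector"
  assumes dec: "\<And>k. N \<le> k \<Longrightarrow> F (Suc k) \<le> F k - c * (norm (d k))\<^sup>2"
    and c: "0 < c" and bdd: "\<And>k. b \<le> F k"
  shows "d \<longlonglongrightarrow> 0"
proof -
  let ?G = "\<lambda>k. F (k + N)"
  have dec': "c * (norm (d (k + N)))\<^sup>2 \<le> ?G k - ?G (Suc k)" for k
    using dec[of "k + N"] by simp
  have "?G (Suc k) \<le> ?G k" for k
    using dec'[of k] c by (smt (verit) mult_nonneg_nonneg zero_le_power2)
  then obtain l where l: "?G \<longlonglongrightarrow> l"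
    using decseq_convergent[of ?G b] bdd by (metis decseq_SucI)
  have "(\<lambda>k. (?G k - ?G (Suc k)) / c) \<longlonglongrightarrow> (l - l) / c"
    using c by (intro tendsto_intros l LIMSEQ_Suc[OF l]) auto
  from tendsto_real_sqrt[OF this]
  have lim: "(\<lambda>k. sqrt ((?G k - ?G (Suc k)) / c)) \<longlonglongrightarrow> 0" by simp
  have "norm (d (k + N)) \<le> sqrt ((?G k - ?G (Suc k)) / c)" for k
    using dec'[of k] c by (intro real_le_rsqrt) (simp add: pos_le_divide_eq mult.commute)
  then have "eventually (\<lambda>k. norm (d (k + N)) \<le> sqrt ((?G k - ?G (Suc k)) / c)) sequentially"
    by (intro always_eventually allI)
  from Lim_null_comparison[OF this lim] have "(\<lambda>k. d (k + N)) \<longlonglongrightarrow> 0" .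
  then show ?thesis by (rule LIMSEQ_offset)
qed

lemma variational_inequality_limit:
  fixes g x e :: "nat \<Rightarrow> 'a::real_inner"
  assumes "eventually (\<lambda>k. 0 \<le> g k \<bullet> (z - x k) + M * norm (e k) * norm (z - x k)) sequentially"
    and "g \<longlonglongrightarrow> g0" and "x \<longlonglongrightarrow> x0" and "e \<longlonglongrightarrow> 0"
  shows "0 \<le> g0 \<bullet> (z - x0)"
proof -
  have "(\<lambda>k. g k \<bullet> (z - x k) + M * norm (e k) * norm (z - x k))
      \<longlonglongrightarrow> g0 \<bullet> (z - x0) + M * norm (0 :: 'a) * norm (z - x0)"
    by (intro tendsto_intros assms)
  then show ?thesis using tendsto_lowerbound[OF _ assms(1)] by simp
qed

section \<open>Strong stationarity\<close>

lemma minus_gradient_in_normal_cone: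
  fixes G X :: "real^'d^'r"
  assumes X: "X \<in> Omega \<sigma>" and G: "\<And>i. i \<notin> J \<Longrightarrow> column i G = 0"
    and vi: "\<And>i z. i \<in> J \<Longrightarrow> norm z \<le> \<sigma> \<Longrightarrow> 0 \<le> column i G \<bullet> (z - column i X)"
  shows "0 \<in> (+) G ` normal_cone (col_space J) (col_sub J ` Omega \<sigma>) (col_sub J X)"
proof
  have "- G \<bullet> (col_sub J Z - col_sub J X) \<le> 0" if "Z \<in> Omega \<sigma>" for Z :: "real^'d^'r"
  proof -
    have "0 \<le> (\<Sum>i\<in>UNIV. column i G \<bullet> (column i (col_sub J Z) - column i (col_sub J X)))"
      using that vi by (intro sum_nonneg) (auto simp: column_col_sub Omega_def)
    then show ?thesis by (simp add: inner_columns[of G])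
  qed
  then show "- G \<in> normal_cone (col_space J) (col_sub J ` Omega \<sigma>) (col_sub J X)"
    using X G by (auto simp: normal_cone_def col_space_def)
qed simp

text \<open>
  Truncation to the common support \<open>J\<close> does not change the product, hence not the gradient
  \<open>H\<close>; and for \<open>i \<in> J\<close> the columns entering the conditions are unchanged as well.
\<close>

lemma S_map_strong_stationary:
  fixes X :: "real^'d^'m" and Y :: "real^'d^'n"
  assumes X: "X \<in> Omega \<sigma>" and Y: "Y \<in> Omega \<sigma>" and \<sigma>: "0 \<le> \<sigma>" and cb: "col_bound \<nu> X Y"
    and H: "H \<in> limiting_subdiff f (X ** transpose Y)"
    and vX: "\<And>i z. column i X \<noteq> 0 \<Longrightarrow> norm z \<le> \<sigma> \<Longrightarrow> 0 \<le> (H *v column i Y) \<bullet> (z - column i X)"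
    and vY: "\<And>i z. column i Y \<noteq> 0 \<Longrightarrow> norm z \<le> \<sigma> \<Longrightarrow>
               0 \<le> (transpose H *v column i X) \<bullet> (z - column i Y)"
  shows "S_map X Y \<in> strong_stationary f \<sigma> \<nu>"
proof -
  define J where "J = col_supp X \<inter> col_supp Y"
  let ?X = "col_sub J X" and ?Y = "col_sub J Y"
  have suppX: "col_supp ?X = J" and suppY: "col_supp ?Y = J"
    by (auto intro!: col_supp_col_sub simp: J_def)
  have idem: "col_sub J ?X = ?X" "col_sub J ?Y = ?Y"
    using suppX suppY by (auto intro: col_sub_col_supp)
  have Om: "?X \<in> Omega \<sigma>" "?Y \<in> Omega \<sigma>" using X Y \<sigma> by (auto intro: col_sub_Omega)
  have prod: "?X ** transpose ?Y = X ** transpose Y"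
    by (rule mult_transpose_col_sub) (auto simp: J_def col_supp_def)
  have nz: "column i X \<noteq> 0" "column i Y \<noteq> 0" if "i \<in> J" for i
    using that by (auto simp: J_def col_supp_def)
  have "0 \<in> (+) (H ** ?Y) ` normal_cone (col_space J) (col_sub J ` Omega \<sigma>) (col_sub J ?X)"
    using nz vX by (intro minus_gradient_in_normal_cone[OF Om(1)])
      (simp_all add: column_matrix_mult column_col_sub)
  moreover have "0 \<in> (+) (transpose H ** ?X) ` normal_cone (col_space J) (col_sub J ` Omega \<sigma>) (col_sub J ?Y)"
    using nz vY by (intro minus_gradient_in_normal_cone[OF Om(2)])
      (simp_all add: column_matrix_mult column_col_sub del: transpose_matrix_vector)
  moreover have "col_bound \<nu> ?X ?Y"
    using cb by (auto simp: col_bound_def column_col_sub)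
  ultimately have "(?X, ?Y) \<in> strong_stationary f \<sigma> \<nu>"
    using H Om unfolding strong_stationary_def
    by (auto simp: Let_def suppX suppY idem prod col_consistent_def)
  then show ?thesis by (simp add: S_map_col_sub J_def)
qed

section \<open>Convergence of the algorithm\<close>

theorem theorem11:
  fixes f :: "real^'n^'m \<Rightarrow> real"
    and gradf :: "real^'n^'m \<Rightarrow> real^'n^'m"
    and X Xb :: "nat \<Rightarrow> real^'d^'m"
    and Y Yb :: "nat \<Rightarrow> real^'d^'n"
    and lam \<sigma> \<kappa> \<nu> Lf cmin cmax \<iota>min \<iota>max \<rho> :: real
    and KK :: "nat set" and K :: nat and nus :: "nat \<Rightarrow> real"
  assumes dims: "CARD('m) \<ge> CARD('n)"
    and lam: "lam > 0" and sigma: "\<sigma> > 0"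
    and f_lip: "locally_lipschitz f"
    and f_grad: "\<And>Z. GDERIV f Z :> gradf Z"
    and gradf_lip: "Lf-lipschitz_on
          {P ** transpose Q | (P :: real^'d^'m) (Q :: real^'d^'n). P \<in> Omega \<sigma> \<and> Q \<in> Omega \<sigma>} gradf"
    and kappa: "\<kappa> > 0"
    and kappa_bound: "\<And>(P :: real^'d^'m) (Q :: real^'d^'n) H i.
          P \<in> Omega \<sigma> \<Longrightarrow> Q \<in> Omega \<sigma> \<Longrightarrow> H \<in> limiting_subdiff f (P ** transpose Q) \<Longrightarrow>
          max (norm (H *v column i Q)) (norm (transpose H *v column i P)) \<le> \<kappa>"
    and nu: "0 < \<nu>" "\<nu> < min (lam / \<kappa>) \<sigma>"
    and c: "0 < cmin" "cmin < cmax"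
    and iota: "0 < \<iota>min" "\<iota>min < \<iota>max"
    and rho: "\<rho> > 1"
    and nus_pos: "\<And>k. nus k > 0"
    and nus_eq: "\<And>k. k \<ge> K \<Longrightarrow> nus k = \<nu>"
    and generated: "generated_by_algorithm f gradf \<sigma> lam cmin cmax \<iota>min \<iota>max \<rho> KK nus X Y Xb Yb"
  shows
    "(\<exists>(Khat::nat) IX IY. Khat > 0 \<and>
        (\<forall>k\<ge>Khat. col_supp (X k) = IX \<and> col_supp (Y k) = IY \<and>
                  (X k, Y k) = (Xb k, Yb k) \<and> col_bound \<nu> (X k) (Y k)) \<and>
        (infinite KK \<longrightarrow>
           (\<forall>k > (LEAST j. j \<in> KK \<and> j \<ge> Khat - 1). col_consistent (X k) (Y k)))) \<and>
     (\<forall>Xs Ys. accumulation_point (\<lambda>k. (X k, Y k)) (Xs, Ys) \<longrightarrow>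
        (if infinite KK then (Xs, Ys) \<in> strong_stationary f \<sigma> \<nu>
         else S_map Xs Ys \<in> strong_stationary f \<sigma> \<nu>))"
proof -
  let ?G = "\<lambda>(P :: real^'d^'m) (Q :: real^'d^'n). gradf (P ** transpose Q)"
  have start: "X 0 \<in> Omega \<sigma>" "Y 0 \<in> Omega \<sigma>"
    and stepX: "\<And>k. \<exists>\<iota>\<in>{\<iota>min..\<iota>max}. \<exists>c\<in>{cmin..cmax}.
          X_step f gradf \<sigma> lam \<rho> (nus k) \<iota> c (X k) (Y k) (Xb (Suc k))"
    and stepY: "\<And>k. \<exists>\<iota>\<in>{\<iota>min..\<iota>max}. \<exists>c\<in>{cmin..cmax}.
          Y_step f gradf \<sigma> lam \<rho> (nus k) \<iota> c (Xb (Suc k)) (Y k) (Yb (Suc k))"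
    and update: "\<And>k. (X (Suc k), Y (Suc k)) =
         (if k \<in> KK then S_map (Xb (Suc k)) (Yb (Suc k)) else (Xb (Suc k), Yb (Suc k)))"
    using generated unfolding generated_by_algorithm_def by blast+
  have XbO: "Xb (Suc k) \<in> Omega \<sigma>" for k
    using stepX[of k] X_step_accepted(1) by blast
  have YbO: "Yb (Suc k) \<in> Omega \<sigma>" for k
    using stepY[of k] Y_step_accepted(1) by blast
  have eraseX: "column i (X (Suc k)) = 0 \<or> column i (X (Suc k)) = column i (Xb (Suc k))" for k i
    using update[of k] by (auto simp: S_map_col_sub column_col_sub split: if_splits)
  have eraseY: "column i (Y (Suc k)) = 0 \<or> column i (Y (Suc k)) = column i (Yb (Suc k))" for k i
    using update[of k] by (auto simp: S_map_col_sub column_col_sub split: if_splits)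
  have XO: "X k \<in> Omega \<sigma>" for k
  proof (cases k)
    case (Suc j)
    show ?thesis
      using eraseX[of _ j] XbO[of j] sigma unfolding Suc Omega_def by (smt (verit) mem_Collect_eq norm_zero)
  qed (use start in simp)
  have YO: "Y k \<in> Omega \<sigma>" for k
  proof (cases k)
    case (Suc j)
    show ?thesis
      using eraseY[of _ j] YbO[of j] sigma unfolding Suc Omega_def by (smt (verit) mem_Collect_eq norm_zero)
  qed (use start in simp)

  obtain L where majorX: "\<And>(P :: real^'d^'m) W (Q :: real^'d^'n). P \<in> Omega \<sigma> \<Longrightarrow> W \<in> Omega \<sigma> \<Longrightarrow> Q \<in> Omega \<sigma> \<Longrightarrow>
       f (W ** transpose Q) \<le> f (P ** transpose Q) + (?G P Q ** Q) \<bullet> (W - P) + L * (norm (W - P))\<^sup>2"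
    and majorY: "\<And>(P :: real^'d^'m) W (Q :: real^'d^'n). P \<in> Omega \<sigma> \<Longrightarrow> W \<in> Omega \<sigma> \<Longrightarrow> Q \<in> Omega \<sigma> \<Longrightarrow>
       f (P ** transpose W) \<le> f (P ** transpose Q) + (transpose (?G P Q) ** P) \<bullet> (W - Q)
         + L * (norm (W - Q))\<^sup>2"
    using product_majorants[OF f_grad gradf_lip] by blast
  \<comment> \<open>\<open>M\<close> bounds the accepted proximal weights in both blocks and all iterations.\<close>
  define M where "M = max \<iota>max (2 * \<rho> * (L + cmax))"
  define \<delta> where "\<delta> = (lam / \<nu> - \<kappa>) / M"
  have M: "0 < M" using iota by (simp add: M_def)
  have slope: "\<kappa> < lam / \<nu>"
    using nu kappa by (simp add: field_simps)
  then have \<delta>: "0 < \<delta>" using M by (simp add: \<delta>_def)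
  \<comment> \<open>The gradient is a limiting subgradient, so \<open>\<kappa>\<close> bounds its columns in both models.\<close>
  have gradX: "norm (column i (?G P Q ** Q)) \<le> \<kappa>"
    and gradY: "norm (column i (transpose (?G P Q) ** P)) \<le> \<kappa>"
    if "P \<in> Omega \<sigma>" "Q \<in> Omega \<sigma>" for P :: "real^'d^'m" and Q :: "real^'d^'n" and i
    using kappa_bound[OF that gradient_in_limiting_subdiff[OF f_grad], of i]
    by (simp_all add: column_matrix_mult del: transpose_matrix_vector)

  have shrinkX: "column i (Xb (Suc k)) = 0 \<or> norm (column i (Xb (Suc k))) \<le> norm (column i (X k)) - \<delta>"
    if k: "K \<le> k" and small: "norm (column i (X k)) < \<nu>" for k i
  proof -
    obtain \<iota> c where *: "\<iota> \<in> {\<iota>min..\<iota>max}" "c \<in> {cmin..cmax}"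
      "X_step f gradf \<sigma> lam \<rho> \<nu> \<iota> c (X k) (Y k) (Xb (Suc k))"
      using stepX[of k] nus_eq[OF k] by auto
    show ?thesis
      unfolding \<delta>_def
      by (rule backtracking_step_columns(1)[OF *(3)[unfolded X_step_prox_model] majorX _ _ _ _ _ _ _ _ gradX])
        (use XO YO sigma lam nu rho iota c * slope M_def small in auto)
  qed
  have viX: "0 \<le> (?G (X k) (Y k) *v column i (Y k)) \<bullet> (z - column i (Xb (Suc k)))
        + M * norm (column i (Xb (Suc k)) - column i (X k)) * norm (z - column i (Xb (Suc k)))"
    if k: "K \<le> k" and large: "\<nu> \<le> norm (column i (X k))" and z: "norm z \<le> \<sigma>" for k i z
  proof -
    obtain \<iota> c where *: "\<iota> \<in> {\<iota>min..\<iota>max}" "c \<in> {cmin..cmax}"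
      "X_step f gradf \<sigma> lam \<rho> \<nu> \<iota> c (X k) (Y k) (Xb (Suc k))"
      using stepX[of k] nus_eq[OF k] by auto
    show ?thesis
      unfolding column_matrix_mult[symmetric]
      by (rule backtracking_step_columns(2)[OF *(3)[unfolded X_step_prox_model] majorX _ _ _ _ _ _ _ _ gradX])
        (use XO YO sigma lam nu rho iota c * slope M_def large z in auto)
  qed
  have decX: "f (Xb (Suc k) ** transpose (Y k)) + lam * Theta \<nu> (Xb (Suc k))
        \<le> f (X k ** transpose (Y k)) + lam * Theta \<nu> (X k) - cmin * (norm (Xb (Suc k) - X k))\<^sup>2"
    if k: "K \<le> k" for k
  proof -
    obtain \<iota> c where *: "\<iota> \<in> {\<iota>min..\<iota>max}" "c \<in> {cmin..cmax}"
      "X_step f gradf \<sigma> lam \<rho> \<nu> \<iota> c (X k) (Y k) (Xb (Suc k))"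
      using stepX[of k] nus_eq[OF k] by auto
    from * have "cmin * (norm (Xb (Suc k) - X k))\<^sup>2 \<le> c * (norm (Xb (Suc k) - X k))\<^sup>2"
      by (intro mult_right_mono) auto
    with X_step_accepted(2)[OF *(3)] show ?thesis by linarith
  qed

  have shrinkY: "column i (Yb (Suc k)) = 0 \<or> norm (column i (Yb (Suc k))) \<le> norm (column i (Y k)) - \<delta>"
    if k: "K \<le> k" and small: "norm (column i (Y k)) < \<nu>" for k i
  proof -
    obtain \<iota> c where *: "\<iota> \<in> {\<iota>min..\<iota>max}" "c \<in> {cmin..cmax}"
      "Y_step f gradf \<sigma> lam \<rho> \<nu> \<iota> c (Xb (Suc k)) (Y k) (Yb (Suc k))"
      using stepY[of k] nus_eq[OF k] by auto
    show ?thesis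
      unfolding \<delta>_def
      by (rule backtracking_step_columns(1)[OF *(3)[unfolded Y_step_prox_model] majorY _ _ _ _ _ _ _ _ gradY])
        (use XbO YO sigma lam nu rho iota c * slope M_def small in auto)
  qed
  have viY: "0 \<le> (transpose (?G (Xb (Suc k)) (Y k)) *v column i (Xb (Suc k))) \<bullet> (z - column i (Yb (Suc k)))
        + M * norm (column i (Yb (Suc k)) - column i (Y k)) * norm (z - column i (Yb (Suc k)))"
    if k: "K \<le> k" and large: "\<nu> \<le> norm (column i (Y k))" and z: "norm z \<le> \<sigma>" for k i z
  proof -
    obtain \<iota> c where *: "\<iota> \<in> {\<iota>min..\<iota>max}" "c \<in> {cmin..cmax}"
      "Y_step f gradf \<sigma> lam \<rho> \<nu> \<iota> c (Xb (Suc k)) (Y k) (Yb (Suc k))"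
      using stepY[of k] nus_eq[OF k] by auto
    show ?thesis
      unfolding column_matrix_mult[symmetric]
      by (rule backtracking_step_columns(2)[OF *(3)[unfolded Y_step_prox_model] majorY _ _ _ _ _ _ _ _ gradY])
        (use XbO YO sigma lam nu rho iota c * slope M_def large z in auto)
  qed
  have decY: "f (Xb (Suc k) ** transpose (Yb (Suc k))) + lam * Theta \<nu> (Yb (Suc k))
        \<le> f (Xb (Suc k) ** transpose (Y k)) + lam * Theta \<nu> (Y k) - cmin * (norm (Yb (Suc k) - Y k))\<^sup>2"
    if k: "K \<le> k" for k
  proof -
    obtain \<iota> c where *: "\<iota> \<in> {\<iota>min..\<iota>max}" "c \<in> {cmin..cmax}"
      "Y_step f gradf \<sigma> lam \<rho> \<nu> \<iota> c (Xb (Suc k)) (Y k) (Yb (Suc k))"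
      using stepY[of k] nus_eq[OF k] by auto
    from * have "cmin * (norm (Yb (Suc k) - Y k))\<^sup>2 \<le> c * (norm (Yb (Suc k) - Y k))\<^sup>2"
      by (intro mult_right_mono) auto
    with Y_step_accepted(2)[OF *(3)] show ?thesis by linarith
  qed

  obtain NX IX where NX: "K \<le> NX" and largeX: "\<And>k i. NX \<le> k \<Longrightarrow> i \<in> IX \<Longrightarrow> \<nu> \<le> norm (column i (X k))"
    and zeroX: "\<And>k i. NX \<le> k \<Longrightarrow> i \<notin> IX \<Longrightarrow> column i (X k) = 0"
    and keepX: "\<And>k. NX \<le> k \<Longrightarrow> X (Suc k) = Xb (Suc k)"
    by (rule block_stabilizes[where Z = X and Zb = Xb and K = K, OF \<delta> nu(1) eraseX shrinkX]) blast+
  obtain NY IY where NY: "K \<le> NY" and largeY: "\<And>k i. NY \<le> k \<Longrightarrow> i \<in> IY \<Longrightarrow> \<nu> \<le> norm (column i (Y k))"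
    and zeroY: "\<And>k i. NY \<le> k \<Longrightarrow> i \<notin> IY \<Longrightarrow> column i (Y k) = 0"
    and keepY: "\<And>k. NY \<le> k \<Longrightarrow> Y (Suc k) = Yb (Suc k)"
    by (rule block_stabilizes[where Z = Y and Zb = Yb and K = K, OF \<delta> nu(1) eraseY shrinkY]) blast+
  define N where "N = max NX NY"
  have N: "K \<le> N" "NX \<le> N" "NY \<le> N" using NX by (auto simp: N_def)
  have suppX: "col_supp (X k) = IX" if "N \<le> k" for k
    using largeX[of k] zeroX[of k] nu(1) that N unfolding col_supp_def by fastforce
  have suppY: "col_supp (Y k) = IY" if "N \<le> k" for k
    using largeY[of k] zeroY[of k] nu(1) that N unfolding col_supp_def by fastforce
  have bound: "col_bound \<nu> (X k) (Y k)" if "N \<le> k" for k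
    unfolding col_bound_def
    using largeX[of k] zeroX[of k] largeY[of k] zeroY[of k] that N by (smt (verit) greaterThanLessThan_iff norm_zero order_trans)

  \<comment> \<open>A truncation at a time when the supports are already final equates them.\<close>
  have consistent: "IX = IY" if j: "j \<in> KK" "N \<le> j" for j
  proof -
    have "col_supp (X (Suc j)) = col_supp (Y (Suc j))"
      using update[of j] j by (auto simp: S_map_col_sub col_supp_col_sub)
    then show ?thesis using suppX suppY j by auto
  qed

  have part1: "\<exists>(Khat::nat) IX IY. Khat > 0 \<and>
        (\<forall>k\<ge>Khat. col_supp (X k) = IX \<and> col_supp (Y k) = IY \<and>
                  (X k, Y k) = (Xb k, Yb k) \<and> col_bound \<nu> (X k) (Y k)) \<and>
        (infinite KK \<longrightarrow>
           (\<forall>k > (LEAST j. j \<in> KK \<and> j \<ge> Khat - 1). col_consistent (X k) (Y k)))"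
  proof (intro exI conjI allI impI)
    show "0 < Suc N" by simp
  next
    fix k assume k: "Suc N \<le> k"
    \<comment> \<open>The predecessor must be late as well, since \<open>X k = Xb k\<close> concerns the step leading to \<open>k\<close>.\<close>
    then obtain j where j: "k = Suc j" "N \<le> j" by (cases k) auto
    show "col_supp (X k) = IX" "col_supp (Y k) = IY" "col_bound \<nu> (X k) (Y k)"
      using k suppX[of k] suppY[of k] bound[of k] by simp_all
    show "(X k, Y k) = (Xb k, Yb k)"
      using keepX[of j] keepY[of j] j N by simp
  next
    fix k assume inf: "infinite KK" and k: "(LEAST j. j \<in> KK \<and> j \<ge> Suc N - 1) < k"
    let ?j = "LEAST j. j \<in> KK \<and> j \<ge> Suc N - 1"
    have "\<exists>j. j \<in> KK \<and> j \<ge> Suc N - 1"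
      using inf by (metis infinite_nat_iff_unbounded_le)
    then have j: "?j \<in> KK \<and> ?j \<ge> Suc N - 1" by (rule LeastI_ex)
    with consistent[of ?j] suppX suppY k show "col_consistent (X k) (Y k)"
      by (simp add: col_consistent_def)
  qed

  obtain b where b: "\<And>(P :: real^'d^'m) (Q :: real^'d^'n). P \<in> Omega \<sigma> \<Longrightarrow> Q \<in> Omega \<sigma> \<Longrightarrow> b \<le> f (P ** transpose Q)"
  proof -
    have "continuous_on UNIV f"
      using f_grad unfolding gderiv_def by (meson continuous_at_imp_continuous_on has_derivative_continuous)
    then have "continuous_on (Omega \<sigma> \<times> Omega \<sigma>) (\<lambda>p. f (fst p ** transpose (snd p :: real^'d^'n) :: real^'n^'m))"
      by (rule continuous_on_compose2)
        (auto intro!: bounded_bilinear.continuous_on[OF bounded_bilinear_mult_transpose] continuous_intros)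
    moreover have "compact ((Omega \<sigma> :: (real^'d^'m) set) \<times> (Omega \<sigma> :: (real^'d^'n) set))"
      by (intro compact_Times compact_Omega)
    moreover have "(X 0, Y 0) \<in> Omega \<sigma> \<times> Omega \<sigma>" using start by simp
    ultimately obtain p where "\<forall>q\<in>Omega \<sigma> \<times> Omega \<sigma>. f (fst p ** transpose (snd p :: real^'d^'n))
        \<le> f (fst q ** transpose (snd q :: real^'d^'n))"
      using continuous_attains_inf by (metis (no_types, lifting) empty_iff)
    then show thesis using that by fastforce
  qed
  define F where "F k = f (X k ** transpose (Y k)) + lam * Theta \<nu> (X k) + lam * Theta \<nu> (Y k)" for k
  have Fb: "b \<le> F k" for k
  proof -
    have "0 \<le> lam * Theta \<nu> (X k)" "0 \<le> lam * Theta \<nu> (Y k)"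
      using lam nu(1) by (auto intro!: mult_nonneg_nonneg sum_nonneg simp: Theta_def theta_def theta_piece_def)
    with b[OF XO YO, of k k] show ?thesis by (simp add: F_def)
  qed
  have Fdec: "F (Suc k) \<le> F k - cmin * (norm (X (Suc k) - X k))\<^sup>2 - cmin * (norm (Y (Suc k) - Y k))\<^sup>2"
    if "N \<le> k" for k
    using decX[of k] decY[of k] keepX[of k] keepY[of k] that N by (simp add: F_def)
  have nonneg: "0 \<le> cmin * (norm v)\<^sup>2" "0 \<le> cmin * (norm w)\<^sup>2" for v :: "real^'d^'m" and w :: "real^'d^'n"
    using c by auto
  have dX: "(\<lambda>k. X (Suc k) - X k) \<longlonglongrightarrow> 0"
    by (rule sufficient_decrease_steps_vanish[of N F cmin _ b]) (use Fdec Fb c nonneg in \<open>smt (verit)\<close>)+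
  have dY: "(\<lambda>k. Y (Suc k) - Y k) \<longlonglongrightarrow> 0"
    by (rule sufficient_decrease_steps_vanish[of N F cmin _ b]) (use Fdec Fb c nonneg in \<open>smt (verit)\<close>)+

  have part2: "if infinite KK then (Xs, Ys) \<in> strong_stationary f \<sigma> \<nu>
         else S_map Xs Ys \<in> strong_stationary f \<sigma> \<nu>"
    if acc: "accumulation_point (\<lambda>k. (X k, Y k)) (Xs, Ys)" for Xs Ys
  proof -
    obtain r where r: "strict_mono r" and lim: "((\<lambda>k. (X k, Y k)) \<circ> r) \<longlonglongrightarrow> (Xs, Ys)"
      using acc unfolding accumulation_point_def by blast
    have limX: "(\<lambda>j. X (r j)) \<longlonglongrightarrow> Xs" using tendsto_fst[OF lim] by (simp add: o_def)
    have limY: "(\<lambda>j. Y (r j)) \<longlonglongrightarrow> Ys" using tendsto_snd[OF lim] by (simp add: o_def)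
    have dXr: "(\<lambda>j. X (Suc (r j)) - X (r j)) \<longlonglongrightarrow> 0"
      using LIMSEQ_subseq_LIMSEQ[OF dX r] by (simp add: o_def)
    have dYr: "(\<lambda>j. Y (Suc (r j)) - Y (r j)) \<longlonglongrightarrow> 0"
      using LIMSEQ_subseq_LIMSEQ[OF dY r] by (simp add: o_def)
    have limX': "(\<lambda>j. X (Suc (r j))) \<longlonglongrightarrow> Xs" using tendsto_add[OF dXr limX] by simp
    have limY': "(\<lambda>j. Y (Suc (r j))) \<longlonglongrightarrow> Ys" using tendsto_add[OF dYr limY] by simp
    have late: "eventually (\<lambda>j. N \<le> r j) sequentially"
      using filterlim_subseq[OF r] by (simp add: filterlim_at_top)
    have Om: "Xs \<in> Omega \<sigma>" "Ys \<in> Omega \<sigma>"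
      using closed_sequentially[OF closed_Omega _ limX] closed_sequentially[OF closed_Omega _ limY] XO YO
      by auto
    have largeXs: "\<nu> \<le> norm (column i Xs)" if "i \<in> IX" for i
      by (rule tendsto_lowerbound[OF tendsto_norm[OF tendsto_column[OF limX]]])
        (use late that N in \<open>auto elim!: eventually_mono intro: largeX\<close>)
    have largeYs: "\<nu> \<le> norm (column i Ys)" if "i \<in> IY" for i
      by (rule tendsto_lowerbound[OF tendsto_norm[OF tendsto_column[OF limY]]])
        (use late that N in \<open>auto elim!: eventually_mono intro: largeY\<close>)
    have zeroXs: "column i Xs = 0" if "i \<notin> IX" for i
    proof (rule tendsto_unique[OF _ tendsto_column[OF limX]])
      show "(\<lambda>j. column i (X (r j))) \<longlonglongrightarrow> 0"
        by (rule tendsto_eventually) (use late that N in \<open>auto elim!: eventually_mono intro: zeroX\<close>)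
    qed simp
    have zeroYs: "column i Ys = 0" if "i \<notin> IY" for i
    proof (rule tendsto_unique[OF _ tendsto_column[OF limY]])
      show "(\<lambda>j. column i (Y (r j))) \<longlonglongrightarrow> 0"
        by (rule tendsto_eventually) (use late that N in \<open>auto elim!: eventually_mono intro: zeroY\<close>)
    qed simp
    \<comment> \<open>Two independent sequences, as the \<open>Y\<close>-step mixes the new \<open>X\<close> with the old \<open>Y\<close>.\<close>
    have limG: "(\<lambda>j. ?G (P j) (Q j)) \<longlonglongrightarrow> ?G Xs Ys"
      if "P \<longlonglongrightarrow> Xs" "Q \<longlonglongrightarrow> Ys" "\<And>j. P j \<in> Omega \<sigma>" "\<And>j. Q j \<in> Omega \<sigma>" for P Q
    proof (rule continuous_on_tendsto_compose[OF lipschitz_on_continuous_on[OF gradf_lip]])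
      show "(\<lambda>j. P j ** transpose (Q j)) \<longlonglongrightarrow> Xs ** transpose Ys"
        by (rule bounded_bilinear.tendsto[OF bounded_bilinear_mult_transpose that(1,2)])
    qed (use Om that in \<open>auto intro!: always_eventually\<close>)
    have vX: "0 \<le> (?G Xs Ys *v column i Ys) \<bullet> (z - column i Xs)" if i: "i \<in> IX" and z: "norm z \<le> \<sigma>" for i z
    proof (rule variational_inequality_limit)
      show "eventually (\<lambda>j. 0 \<le> (?G (X (r j)) (Y (r j)) *v column i (Y (r j))) \<bullet> (z - column i (X (Suc (r j))))
          + M * norm (column i (X (Suc (r j)) - X (r j))) * norm (z - column i (X (Suc (r j))))) sequentially"
        using late
      proof (rule eventually_mono)
        fix j assume "N \<le> r j"
        then show "0 \<le> (?G (X (r j)) (Y (r j)) *v column i (Y (r j))) \<bullet> (z - column i (X (Suc (r j))))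
          + M * norm (column i (X (Suc (r j)) - X (r j))) * norm (z - column i (X (Suc (r j))))"
          using viX[of "r j" i z] keepX[of "r j"] largeX[of "r j" i] i z N by simp
      qed
      show "(\<lambda>j. column i (X (Suc (r j)) - X (r j))) \<longlonglongrightarrow> 0" using tendsto_column[OF dXr, of i] by simp
    qed (intro tendsto_matrix_vector_mult tendsto_column limG limX limY limX' XO YO)+
    have vY: "0 \<le> (transpose (?G Xs Ys) *v column i Xs) \<bullet> (z - column i Ys)" if i: "i \<in> IY" and z: "norm z \<le> \<sigma>" for i z
    proof (rule variational_inequality_limit)
      show "eventually (\<lambda>j. 0 \<le> (transpose (?G (X (Suc (r j))) (Y (r j))) *v column i (X (Suc (r j)))) \<bullet> (z - column i (Y (Suc (r j))))
          + M * norm (column i (Y (Suc (r j)) - Y (r j))) * norm (z - column i (Y (Suc (r j))))) sequentially"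
        using late
      proof (rule eventually_mono)
        fix j assume "N \<le> r j"
        then show "0 \<le> (transpose (?G (X (Suc (r j))) (Y (r j))) *v column i (X (Suc (r j)))) \<bullet> (z - column i (Y (Suc (r j))))
          + M * norm (column i (Y (Suc (r j)) - Y (r j))) * norm (z - column i (Y (Suc (r j))))"
          using viY[of "r j" i z] keepX[of "r j"] keepY[of "r j"] largeY[of "r j" i] i z N
          by (simp del: transpose_matrix_vector)
      qed
      show "(\<lambda>j. column i (Y (Suc (r j)) - Y (r j))) \<longlonglongrightarrow> 0" using tendsto_column[OF dYr, of i] by simp
    qed (intro tendsto_matrix_vector_mult tendsto_transpose tendsto_column limG limX' limY limY' XO YO)+
    have "S_map Xs Ys \<in> strong_stationary f \<sigma> \<nu>"
    proof (rule S_map_strong_stationary[OF Om])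
      show "col_bound \<nu> Xs Ys"
        unfolding col_bound_def using largeXs zeroXs largeYs zeroYs
        by (smt (verit) greaterThanLessThan_iff norm_zero)
      show "?G Xs Ys \<in> limiting_subdiff f (Xs ** transpose Ys)"
        by (rule gradient_in_limiting_subdiff[OF f_grad])
      show "0 \<le> (?G Xs Ys *v column i Ys) \<bullet> (z - column i Xs)" if "column i Xs \<noteq> 0" "norm z \<le> \<sigma>" for i z
        using that zeroXs vX by blast
      show "0 \<le> (transpose (?G Xs Ys) *v column i Xs) \<bullet> (z - column i Ys)"
        if "column i Ys \<noteq> 0" "norm z \<le> \<sigma>" for i z
        using that zeroYs vY by blast
    qed (use sigma in simp)
    moreover have "S_map Xs Ys = (Xs, Ys)" if inf: "infinite KK"
    proof -
      obtain j where "j \<in> KK" "N \<le> j"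
        using inf by (metis infinite_nat_iff_unbounded_le)
      then have "IX = IY" by (rule consistent)
      moreover have "col_supp Xs = IX" "col_supp Ys = IY"
        using largeXs zeroXs largeYs zeroYs nu(1) unfolding col_supp_def by fastforce+
      ultimately show ?thesis by (simp add: S_map_col_sub col_sub_col_supp)
    qed
    ultimately show ?thesis by (cases "finite KK") auto
  qed
  from part1 part2 show ?thesis by blast
qed

end
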